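(* Let $g\in C^\omega(\mathbb{R})$ with $g(v)>0$ for $v>0$, let $\beta\in\mathbb{R}$, and let $y$ be a maximal solution of the toy model with parameter $\beta$. The following are equivalent: (1) $y$ is a toy tip solution up to a translation of the independent variable (i.e. $s\mapsto y(s+c)$ is a toy tip solution for some constant $c$); (2) $\mathrm{range}(y)=W^{\rm tip}_\beta$.
   Context: Toy model: $\rho'=\frac32\frac{1-\rho^2}{r}\Big(-1+\frac{\sqrt{1-\rho^2}(\beta r^2g(r^2)+\rho)}{r}\Big)$, $r'=\rho$ on $M_0=(-1,1)\times\mathbb{R}_{>0}$, with flow $\phi_\beta$. A toy tip solution is a solution $(\rho,r)$ on an interval $(0,s_{\max})$ with: $\lim_{s\to0^+}\rho=1$, $\lim r=0$, $\lim\sqrt{1-\rho^2}/r=\eta_0>0$; there exist $s_0>0$ and real-analytic $G:(-a,a)\to\mathbb{R}_{>0}$, $a=r(s_0)^2$, with $\rho(s)=G(r(s)^2)$ on $(0,s_0)$; and $\rho'<0,\rho>0$ on some $(0,s_0)$. $M_1=(0,1)\times\mathbb{R}_{>0}$; $N_1=\{(\eta,w)\in\mathbb{R}_{>0}\times\mathbb{R}:\eta^2w<1\}$; $N_0=\{(\eta,w)\in N_1:w>0\}$; $\Phi:M_1\to N_0$, $\Phi(\rho,r)=(\sqrt{1-\rho^2}/r,r^2)$. The $(\eta,w)$-system: $\frac{d\eta}{dt}=\frac{\eta}{2}(1-3\eta\sqrt{1-\eta^2w})-\frac32\beta\eta^2wg(w)$, $\frac{dw}{dt}=2w$, with saddle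 equilibrium $q_0=(1/3,0)$ and unstable manifold $W^u_\beta(q_0)$. Define $W^{\rm loc}_\beta=\Phi^{-1}(W^u_\beta(q_0)\cap N_0)$ and $W^{\rm tip}_\beta=\{y_0\in M_0:\exists s_0\in\mathbb{R},\ \phi_\beta(y_0;s_0)\in W^{\rm loc}_\beta\}$. *)

theory Defs
  imports "HOL-Analysis.Analysis"
begin

definition real_analytic_on :: "(real \<Rightarrow> real) \<Rightarrow> real set \<Rightarrow> bool" where
  "real_analytic_on f S \<longleftrightarrow>
     (\<forall>x\<in>S. \<exists>\<delta>>0. \<exists>c::nat \<Rightarrow> real.
        \<forall>t. \<bar>t - x\<bar> < \<delta> \<longrightarrow> (\<lambda>n. c n * (t - x) ^ n) sums f t)"

definition M0 :: "(real \<times> real) set" where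
  "M0 = {(\<rho>, r). -1 < \<rho> \<and> \<rho> < 1 \<and> 0 < r}"

definition M1 :: "(real \<times> real) set" where
  "M1 = {(\<rho>, r). 0 < \<rho> \<and> \<rho> < 1 \<and> 0 < r}"

definition toy_field :: "(real \<Rightarrow> real) \<Rightarrow> real \<Rightarrow> real \<times> real \<Rightarrow> real \<times> real" where
  "toy_field g \<beta> y = (let \<rho> = fst y; r = snd y in
     (3/2 * (1 - \<rho>^2) / r * (-1 + sqrt (1 - \<rho>^2) * (\<beta> * r^2 * g (r^2) + \<rho>) / r), \<rho>))"

definition toy_solution :: "(real \<Rightarrow> real) \<Rightarrow> real \<Rightarrow> (real \<Rightarrow> real \<times> real) \<Rightarrow> real set \<Rightarrow> bool" where
  "toy_solution g \<beta> y I \<longleftrightarrow>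
     (\<forall>s\<in>I. y s \<in> M0 \<and> (y has_vector_derivative toy_field g \<beta> (y s)) (at s))"

definition maximal_toy_solution :: "(real \<Rightarrow> real) \<Rightarrow> real \<Rightarrow> (real \<Rightarrow> real \<times> real) \<Rightarrow> real set \<Rightarrow> bool" where
  "maximal_toy_solution g \<beta> y I \<longleftrightarrow>
     I \<noteq> {} \<and> open I \<and> is_interval I \<and> toy_solution g \<beta> y I \<and>
     (\<forall>z J. open J \<and> is_interval J \<and> I \<subseteq> J \<and> toy_solution g \<beta> z J \<and> (\<forall>s\<in>I. z s = y s)
        \<longrightarrow> J = I)"

definition toy_tip_solution :: "(real \<Rightarrow> real) \<Rightarrow> real \<Rightarrow> (real \<Rightarrow> real \<times> real) \<Rightarrow> real set \<Rightarrow> bool" where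
  "toy_tip_solution g \<beta> y S \<longleftrightarrow>
     (\<exists>smax::ereal. 0 < smax \<and> S = {s. 0 < s \<and> ereal s < smax}) \<and>
     toy_solution g \<beta> y S \<and>
     ((\<lambda>s. fst (y s)) \<longlongrightarrow> 1) (at_right 0) \<and>
     ((\<lambda>s. snd (y s)) \<longlongrightarrow> 0) (at_right 0) \<and>
     (\<exists>\<eta>0>0. ((\<lambda>s. sqrt (1 - (fst (y s))^2) / snd (y s)) \<longlongrightarrow> \<eta>0) (at_right 0)) \<and>
     (\<exists>s0\<in>S. \<exists>G. let a = (snd (y s0))^2 in
        real_analytic_on G {-a<..<a} \<and> (\<forall>v\<in>{-a<..<a}. G v > 0) \<and>
        (\<forall>s\<in>{0<..<s0}. fst (y s) = G ((snd (y s))^2))) \<and>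
     (\<exists>s1>0. {0<..<s1} \<subseteq> S \<and>
        (\<forall>s\<in>{0<..<s1}. deriv (\<lambda>t. fst (y t)) s < 0 \<and> fst (y s) > 0))"

definition N1 :: "(real \<times> real) set" where
  "N1 = {(\<eta>, w). 0 < \<eta> \<and> \<eta>^2 * w < 1}"

definition N0 :: "(real \<times> real) set" where
  "N0 = {(\<eta>, w). (\<eta>, w) \<in> N1 \<and> 0 < w}"

definition Phi :: "real \<times> real \<Rightarrow> real \<times> real" where
  "Phi y = (sqrt (1 - (fst y)^2) / snd y, (snd y)^2)"

definition ew_field :: "(real \<Rightarrow> real) \<Rightarrow> real \<Rightarrow> real \<times> real \<Rightarrow> real \<times> real" where
  "ew_field g \<beta> p = (let \<eta> = fst p; w = snd p in
     (\<eta> / 2 * (1 - 3 * \<eta> * sqrt (1 - \<eta>^2 * w)) - 3/2 * \<beta> * \<eta>^2 * w * g w, 2 * w))"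

definition q0 :: "real \<times> real" where
  "q0 = (1/3, 0)"

definition Wu :: "(real \<Rightarrow> real) \<Rightarrow> real \<Rightarrow> (real \<times> real) set" where
  "Wu g \<beta> = {p. \<exists>z::real \<Rightarrow> real \<times> real. z 0 = p \<and>
     (\<forall>t\<le>0. z t \<in> N1 \<and> (z has_vector_derivative ew_field g \<beta> (z t)) (at t within {..0})) \<and>
     (z \<longlongrightarrow> q0) at_bot}"

definition Wloc :: "(real \<Rightarrow> real) \<Rightarrow> real \<Rightarrow> (real \<times> real) set" where
  "Wloc g \<beta> = {y \<in> M1. Phi y \<in> Wu g \<beta> \<inter> N0}"

definition Wtip :: "(real \<Rightarrow> real) \<Rightarrow> real \<Rightarrow> (real \<times> real) set" where
  "Wtip g \<beta> = {y0 \<in> M0. \<exists>z J s0. maximal_toy_solution g \<beta> z J \<and> 0 \<in> J \<and> z 0 = y0 \<and>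
     s0 \<in> J \<and> z s0 \<in> Wloc g \<beta>}"

end

theory Submission
  imports Defs "HOL-Complex_Analysis.Complex_Analysis" "HOL-Real_Asymp.Real_Asymp"
begin

text \<open>
  In the coordinates $(\eta, w)$ and with time $t = \frac12 \ln w$ + const, a tip solution is an orbit
  on $(-\infty, 0]$ along which $\eta$ converges. Its derivative then has a limit as well, which must
  vanish, so the orbit converges to $q_0$ and lies on the unstable manifold. Conversely,
  the $\eta$-derivative of the $\eta$-equation at $q_0$ is $-\frac12 < 0$, so the squared difference of
  two orbits emanating from $q_0$ with the same $w$ is nonincreasing in $t$ and tends to $0$ at $-\infty$;
  hence the unstable manifold over $w > 0$ is a single orbit. Pulled back to $(\rho, r)$ it reaches
  $r = 0$ in finite time, since $r' = \rho \to 1$.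

  Analyticity of $G$ comes from the Briot-Bouquet equation $2 w \eta'(w) = E(\eta, w)$ with
  $\eta(0) = \frac13$. With $\eta = \frac13 + u$ and $E = -\frac{u}{2} + F(u, w)$ it is equivalent to
  the fixed-point equation $u(w) = 2 \int_0^1 F(u(s^4 w), s^4 w) \, ds$, a contraction on small
  holomorphic functions near $0$; uniqueness identifies its solution with the unstable manifold, and
  $G(w) = \sqrt{1 - \eta(w)^2 w}$.
\<close>

section \<open>Uniqueness and continuation for the toy model\<close>

text \<open>The fourth power in the fixed-point equation comes from its linear part. The graph
  equation reads \<open>4 * w * u' + u = 2 * F\<close>; its homogeneous solution
  \<open>w powr (-1/4)\<close> is singular at 0, and variation of constants followed by the
  substitution \<open>v = s^4 * w\<close> expresses the bounded solution as a mean over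
  \<open>{0..1}\<close>. A mean does not increase the supremum norm, so a small Lipschitz constant
  of F in u suffices; F has one because the linear part at the equilibrium was split off. A separate
  analytic construction is unavoidable: G must be analytic on both sides of 0, while an orbit
  carries information for w > 0 only. Toy solutions are never produced by an existence theorem. They
  are given, or transported from an orbit in \<open>Wu\<close>, and then compared with a maximal
  solution by uniqueness and gluing. The orbits in \<open>Wu\<close> live on a closed half-line with
  a one-sided derivative at its end, which is why derivatives within sets and intervals that need
  not be open occur. The function g enters twice: as a C1 function on the whole line for uniqueness,
  and as a complex power series near 0.\<close>

lemma real_analytic_C1:
  assumes "real_analytic_on g UNIV"
  obtains g' where "\<And>x. (g has_real_derivative g' x) (at x)" "continuous_on UNIV g'"
proof -
  have *: "(g has_real_derivative deriv g x) (at x) \<and> isCont (deriv g) x" for x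
  proof -
    obtain d c where d: "d > 0" and c: "\<And>t. \<bar>t - x\<bar> < d \<Longrightarrow> (\<lambda>n. c n * (t - x) ^ n) sums g t"
      using assms unfolding real_analytic_on_def by (meson UNIV_I)
    have summ: "summable (\<lambda>n. c n * z ^ n)" if "norm z < d" for z
      using c[of "z + x"] that by (auto simp: sums_iff)
    have summ': "summable (\<lambda>n. diffs c n * z ^ n)" if "norm z < d" for z
      using termdiff_converges[OF that] summ by blast
    define Q where "Q = (\<lambda>z. \<Sum>n. diffs c n * z ^ n)"
    have P: "((\<lambda>z. \<Sum>n. c n * z ^ n) has_real_derivative Q z) (at z)" if "norm z < d" for z
      unfolding Q_def by (rule termdiffs_strong'[OF _ that]) (rule summ)
    \<comment> \<open>The derived series is again a power series with the same disc of convergence,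
      so differentiating it termwise once more gives continuity of \<open>Q\<close>.\<close>
    have Q: "isCont Q 0"
      using termdiffs_strong'[of d "diffs c" 0] summ' d DERIV_isCont unfolding Q_def by force
    have g: "(g has_real_derivative Q (t - x)) (at t)" if "\<bar>t - x\<bar> < d" for t
    proof -
      have "((\<lambda>t. \<Sum>n. c n * (t - x) ^ n) has_real_derivative Q (t - x) * 1) (at t)"
        by (rule DERIV_chain2[OF P]) (use that in \<open>auto intro!: derivative_eq_intros\<close>)
      then show ?thesis
        unfolding mult_1_right
        by (rule has_field_derivative_transform_within_open[where S="ball x d"])
          (use that c in \<open>auto simp: dist_real_def abs_minus_commute sums_iff\<close>)
    qed
    have ev: "\<forall>\<^sub>F t in nhds x. deriv g t = Q (t - x)"
      unfolding eventually_nhds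
      by (rule exI[of _ "ball x d"]) (use d g in \<open>auto simp: dist_real_def abs_minus_commute intro!: DERIV_imp_deriv\<close>)
    have "isCont (\<lambda>t. Q (t - x)) x"
      by (rule continuous_at_compose[unfolded o_def, where g=Q and f="\<lambda>t. t - x"]) (use Q in auto)
    then have "isCont (deriv g) x"
      using isCont_cong[OF ev] by simp
    then show ?thesis
      using g[of x] d DERIV_imp_deriv[OF g[of x]] by auto
  qed
  show ?thesis
    by (rule that[of "deriv g"]) (use * in \<open>auto simp: continuous_on_eq_continuous_at\<close>)
qed

section \<open>Gronwall estimate and local uniqueness\<close>

text \<open>The bound makes \<open>D t * exp (- C * t)\<close> nonincreasing and
  \<open>D t * exp (C * t)\<close> nondecreasing, so a zero at either end forces a zero at the
  other. Both directions are wanted because the common point of two solutions may lie before or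
  after the point of comparison.\<close>

lemma gronwall_zero:
  fixes D D' :: "real \<Rightarrow> real"
  assumes "a \<le> b" and cont: "continuous_on {a..b} D"
    and der: "\<And>t. a < t \<Longrightarrow> t < b \<Longrightarrow> (D has_real_derivative D' t) (at t)"
    and bound: "\<And>t. a < t \<Longrightarrow> t < b \<Longrightarrow> \<bar>D' t\<bar> \<le> C * D t"
    and nonneg: "D a \<ge> 0" "D b \<ge> 0"
    and zero: "D a = 0 \<or> D b = 0"
  shows "D a = 0 \<and> D b = 0"
proof -
  have 1: "D b * exp (- C * b) \<le> D a * exp (- C * a)"
  proof (rule DERIV_nonpos_imp_decreasing_open[OF \<open>a \<le> b\<close>])
    fix t assume t: "a < t" "t < b"
    have "((\<lambda>t. D t * exp (- C * t)) has_real_derivative (D' t - C * D t) * exp (- C * t)) (at t)"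
      by (rule derivative_eq_intros der[OF t] refl | simp add: algebra_simps)+
    moreover have "(D' t - C * D t) * exp (- C * t) \<le> 0"
      using bound[OF t] by (intro mult_nonpos_nonneg) auto
    ultimately show "\<exists>y. ((\<lambda>t. D t * exp (- C * t)) has_real_derivative y) (at t) \<and> y \<le> 0"
      by blast
  qed (intro continuous_intros cont)
  have 2: "D a * exp (C * a) \<le> D b * exp (C * b)"
  proof (rule DERIV_nonneg_imp_increasing_open[OF \<open>a \<le> b\<close>])
    fix t assume t: "a < t" "t < b"
    have "((\<lambda>t. D t * exp (C * t)) has_real_derivative (D' t + C * D t) * exp (C * t)) (at t)"
      by (rule derivative_eq_intros der[OF t] refl | simp add: algebra_simps)+
    moreover have "(D' t + C * D t) * exp (C * t) \<ge> 0"
      using bound[OF t] by (intro mult_nonneg_nonneg) auto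
    ultimately show "\<exists>y. ((\<lambda>t. D t * exp (C * t)) has_real_derivative y) (at t) \<and> 0 \<le> y"
      by blast
  qed (intro continuous_intros cont)
  from zero show ?thesis
  proof
    assume "D a = 0"
    with 1 nonneg show ?thesis
      by (metis exp_gt_zero less_eq_real_def linorder_not_less mult_pos_pos mult_zero_left)
  next
    assume "D b = 0"
    with 2 nonneg show ?thesis
      by (metis exp_gt_zero less_eq_real_def linorder_not_less mult_pos_pos mult_zero_left)
  qed
qed

lemma snd_toy_field: "snd (toy_field g \<beta> y) = fst y"
  by (simp add: toy_field_def Let_def)

text \<open>The formula is singular at r = 0 and its square root is not differentiable at
  \<open>\<bar>\<rho>\<bar> = 1\<close>. The rectangle stays away from both, so the partial
  derivatives \<open>f1\<close> and \<open>f2\<close> are continuous, hence bounded, on it. Two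
  points are joined through (\<open>\<rho>2\<close>, \<open>r1\<close>), which also lies in the
  rectangle, and the mean value inequality is applied on each leg.\<close>

lemma toy_field_lipschitz_rectangle:
  fixes a b c :: real
  assumes g': "\<And>x. (g has_real_derivative g' x) (at x)" "continuous_on UNIV g'"
    and ab: "a < 1" "0 < b"
  obtains L where "0 \<le> L"
    "\<And>\<rho>1 \<rho>2 r1 r2. \<lbrakk>\<bar>\<rho>1\<bar> \<le> a; \<bar>\<rho>2\<bar> \<le> a; b \<le> r1; r1 \<le> c; b \<le> r2; r2 \<le> c\<rbrakk> \<Longrightarrow>
      \<bar>fst (toy_field g \<beta> (\<rho>1, r1)) - fst (toy_field g \<beta> (\<rho>2, r2))\<bar> \<le> L * (\<bar>\<rho>1 - \<rho>2\<bar> + \<bar>r1 - r2\<bar>)"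
proof -
  define f where "f = (\<lambda>\<rho> r. 3/2 * (1 - \<rho>^2) / r * (-1 + sqrt (1 - \<rho>^2) * (\<beta> * r^2 * g (r^2) + \<rho>) / r))"
  define f1 where "f1 = (\<lambda>(\<rho>, r). 3/2 * ((-2*\<rho>) / r * (-1 + sqrt (1 - \<rho>^2) * (\<beta> * r^2 * g (r^2) + \<rho>) / r)
     + (1 - \<rho>^2) / r * ((-\<rho> / sqrt (1 - \<rho>^2)) * (\<beta> * r^2 * g (r^2) + \<rho>) + sqrt (1 - \<rho>^2)) / r))"
  define f2 where "f2 = (\<lambda>(\<rho>, r). 3/2 * (1 - \<rho>^2) * (- (1 / r^2) * (-1 + sqrt (1 - \<rho>^2) * (\<beta> * r^2 * g (r^2) + \<rho>) / r)
     + 1 / r * (sqrt (1 - \<rho>^2) * (\<beta> * (2 * r * g (r^2) + r^2 * (g' (r^2) * (2 * r)))) / r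
        - sqrt (1 - \<rho>^2) * (\<beta> * r^2 * g (r^2) + \<rho>) / r^2)))"
  let ?R = "{-a..a} \<times> {b..c}"
  have sq: "\<rho>^2 < 1" if "\<bar>\<rho>\<bar> \<le> a" for \<rho> :: real
    using that ab by (simp add: abs_square_less_1)
  have contg: "continuous_on UNIV g"
    using g'(1) DERIV_isCont by (auto simp: continuous_on_eq_continuous_at)
  have cg: "continuous_on S (\<lambda>x. g (h x))" "continuous_on S (\<lambda>x. g' (h x))"
    if "continuous_on S h" for h :: "real \<times> real \<Rightarrow> real" and S
    using continuous_on_compose2[OF contg that] continuous_on_compose2[OF g'(2) that] by auto
  \<comment> \<open>The square root enters as an arbitrary differentiable \<open>S\<close>, and
    below the g-term as an arbitrary \<open>E\<close>; what remains to be checked is a rational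
    identity.\<close>
  have D1_aux: "((\<lambda>\<rho>. 3/2 * (1 - \<rho>^2) / r * (-1 + S \<rho> * (E + \<rho>) / r)) has_real_derivative
      3/2 * ((-2*\<rho>) / r * (-1 + S \<rho> * (E + \<rho>) / r) + (1 - \<rho>^2) / r * (S' * (E + \<rho>) + S \<rho>) / r)) (at \<rho>)"
    if "(S has_real_derivative S') (at \<rho>)" "r \<noteq> 0" for S S' E \<rho> r
    using that by (auto intro!: derivative_eq_intros simp: field_simps)
  have D2_aux: "((\<lambda>r. k / r * (-1 + s * (E r + \<rho>) / r)) has_real_derivative
      k * (- (1 / r^2) * (-1 + s * (E r + \<rho>) / r) + 1 / r * (s * E' / r - s * (E r + \<rho>) / r^2))) (at r)"
    if "(E has_real_derivative E') (at r)" "r \<noteq> 0" for E E' k s \<rho> r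
    using that by (auto intro!: derivative_eq_intros simp: field_simps power2_eq_square)
  have D1: "((\<lambda>\<rho>. f \<rho> r) has_real_derivative f1 (\<rho>, r)) (at \<rho>)" if "\<bar>\<rho>\<bar> \<le> a" "b \<le> r" for \<rho> r
  proof -
    have "((\<lambda>\<rho>. sqrt (1 - \<rho>^2)) has_real_derivative - \<rho> / sqrt (1 - \<rho>^2)) (at \<rho>)"
      using sq[OF that(1)] by (auto intro!: derivative_eq_intros simp: field_simps)
    from D1_aux[OF this] show ?thesis
      unfolding f_def f1_def using that ab by simp
  qed
  have D2: "((\<lambda>r. f \<rho> r) has_real_derivative f2 (\<rho>, r)) (at r)" if "\<bar>\<rho>\<bar> \<le> a" "b \<le> r" for \<rho> r
  proof -
    have "((\<lambda>r. \<beta> * r^2 * g (r^2)) has_real_derivative \<beta> * (2 * r * g (r^2) + r^2 * (g' (r^2) * (2 * r)))) (at r)"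
      by (auto intro!: derivative_eq_intros DERIV_chain2[OF g'(1)] simp: algebra_simps)
    from D2_aux[OF this, of "3/2 * (1 - \<rho>^2)" "sqrt (1 - \<rho>^2)" \<rho>] show ?thesis
      unfolding f_def f2_def using that ab by simp
  qed
  have c1: "continuous_on ?R f1"
    unfolding f1_def case_prod_unfold
    by (intro continuous_intros cg) (use ab sq in \<open>fastforce simp: abs_le_iff\<close>)+
  have c2: "continuous_on ?R f2"
    unfolding f2_def case_prod_unfold
    by (intro continuous_intros cg) (use ab sq in \<open>fastforce simp: abs_le_iff\<close>)+
  have comp: "compact ?R"
    by (intro compact_Times) auto
  obtain B1 where B1: "\<And>p. p \<in> ?R \<Longrightarrow> \<bar>f1 p\<bar> \<le> B1"
    using compact_imp_bounded[OF compact_continuous_image[OF c1 comp]] unfolding bounded_iff by auto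
  obtain B2 where B2: "\<And>p. p \<in> ?R \<Longrightarrow> \<bar>f2 p\<bar> \<le> B2"
    using compact_imp_bounded[OF compact_continuous_image[OF c2 comp]] unfolding bounded_iff by auto
  define L where "L = max 0 (max B1 B2)"
  show ?thesis
  proof (rule that[of L])
    fix \<rho>1 \<rho>2 r1 r2 assume A: "\<bar>\<rho>1\<bar> \<le> a" "\<bar>\<rho>2\<bar> \<le> a" "b \<le> r1" "r1 \<le> c" "b \<le> r2" "r2 \<le> c"
    have "norm (f \<rho>1 r1 - f \<rho>2 r1) \<le> L * norm (\<rho>1 - \<rho>2)"
      by (rule field_differentiable_bound[where S="{-a..a}" and f'="\<lambda>\<rho>. f1 (\<rho>, r1)"])
        (use A B1 in \<open>auto simp: L_def abs_le_iff le_max_iff_disj intro!: has_field_derivative_at_within[OF D1]\<close>)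
    moreover have "norm (f \<rho>2 r1 - f \<rho>2 r2) \<le> L * norm (r1 - r2)"
      by (rule field_differentiable_bound[where S="{b..c}" and f'="\<lambda>r. f2 (\<rho>2, r)"])
        (use A B2 in \<open>auto simp: L_def abs_le_iff le_max_iff_disj intro!: has_field_derivative_at_within[OF D2]\<close>)
    ultimately have "\<bar>f \<rho>1 r1 - f \<rho>2 r2\<bar> \<le> L * (\<bar>\<rho>1 - \<rho>2\<bar> + \<bar>r1 - r2\<bar>)"
      by (simp add: distrib_left)
    then show "\<bar>fst (toy_field g \<beta> (\<rho>1, r1)) - fst (toy_field g \<beta> (\<rho>2, r2))\<bar> \<le> L * (\<bar>\<rho>1 - \<rho>2\<bar> + \<bar>r1 - r2\<bar>)"
      by (simp add: f_def toy_field_def Let_def)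
  qed (simp add: L_def)
qed

lemma has_vector_derivative_component_iff:
  fixes f :: "real \<Rightarrow> real \<times> real"
  shows "(f has_vector_derivative v) (at x within S) \<longleftrightarrow>
    ((\<lambda>t. fst (f t)) has_real_derivative fst v) (at x within S) \<and> ((\<lambda>t. snd (f t)) has_real_derivative snd v) (at x within S)"
proof
  assume "(f has_vector_derivative v) (at x within S)"
  then show "((\<lambda>t. fst (f t)) has_real_derivative fst v) (at x within S) \<and> ((\<lambda>t. snd (f t)) has_real_derivative snd v) (at x within S)"
    using bounded_linear.has_vector_derivative[OF bounded_linear_fst, of f v]
      bounded_linear.has_vector_derivative[OF bounded_linear_snd, of f v]
    by (simp add: has_real_derivative_iff_has_vector_derivative)
next
  assume "((\<lambda>t. fst (f t)) has_real_derivative fst v) (at x within S) \<and> ((\<lambda>t. snd (f t)) has_real_derivative snd v) (at x within S)"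
  then have "((\<lambda>t. (fst (f t), snd (f t))) has_derivative (\<lambda>h. (h *\<^sub>R fst v, h *\<^sub>R snd v))) (at x within S)"
    unfolding has_real_derivative_iff_has_vector_derivative has_vector_derivative_def
    by (intro has_derivative_Pair) simp_all
  then show "(f has_vector_derivative v) (at x within S)"
    by (simp add: has_vector_derivative_def scaleR_prod_def)
qed

text \<open>Compactness of the segment between \<open>s0\<close> and \<open>s\<close> puts both
  solutions into one rectangle with a Lipschitz bound, and Gronwall applies to the squared distance.
  Derivatives are taken within \<open>K\<close>, which need not be open: a pulled-back orbit is
  later compared at an endpoint of its domain.\<close>

lemma toy_solution_unique:
  assumes g': "\<And>x. (g has_real_derivative g' x) (at x)" "continuous_on UNIV g'"
    and K: "is_interval K" "s0 \<in> K" "s \<in> K"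
    and y: "\<And>s. s \<in> K \<Longrightarrow> y s \<in> M0"
      "\<And>s. s \<in> K \<Longrightarrow> (y has_vector_derivative toy_field g \<beta> (y s)) (at s within K)"
    and z: "\<And>s. s \<in> K \<Longrightarrow> z s \<in> M0"
      "\<And>s. s \<in> K \<Longrightarrow> (z has_vector_derivative toy_field g \<beta> (z s)) (at s within K)"
    and eq: "y s0 = z s0"
  shows "y s = z s"
proof -
  define l h where "l = min s0 s" and "h = max s0 s"
  have "l \<in> K" "h \<in> K"
    using K by (auto simp: l_def h_def min_def max_def)
  then have lh: "l \<le> h" "{l..h} \<subseteq> K"
    using mem_is_interval_1_I[OF K(1), of l h] by (auto simp: l_def h_def)
  have cy: "continuous_on {l..h} y"
    using continuous_on_vector_derivative[OF y(2)] continuous_on_subset[OF _ lh(2)] by blast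
  have cz: "continuous_on {l..h} z"
    using continuous_on_vector_derivative[OF z(2)] continuous_on_subset[OF _ lh(2)] by blast
  have M: "\<bar>fst (y t)\<bar> < 1" "\<bar>fst (z t)\<bar> < 1" "0 < snd (y t)" "0 < snd (z t)" if "t \<in> {l..h}" for t
    using y(1)[of t] z(1)[of t] subsetD[OF lh(2) that] by (auto simp: M0_def case_prod_unfold)
  have ne: "{l..h} \<noteq> {}" using lh by auto
  obtain a where a: "a < 1" "\<And>t. t \<in> {l..h} \<Longrightarrow> \<bar>fst (y t)\<bar> \<le> a \<and> \<bar>fst (z t)\<bar> \<le> a"
  proof -
    have "continuous_on {l..h} (\<lambda>t. max \<bar>fst (y t)\<bar> \<bar>fst (z t)\<bar>)"
      by (intro continuous_intros cy cz)
    from continuous_attains_sup[OF _ ne this] obtain t0 where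
      "t0 \<in> {l..h}" "\<forall>t\<in>{l..h}. max \<bar>fst (y t)\<bar> \<bar>fst (z t)\<bar> \<le> max \<bar>fst (y t0)\<bar> \<bar>fst (z t0)\<bar>" by auto
    then show ?thesis using M by (intro that[of "max \<bar>fst (y t0)\<bar> \<bar>fst (z t0)\<bar>"]) auto
  qed
  obtain b where b: "0 < b" "\<And>t. t \<in> {l..h} \<Longrightarrow> b \<le> snd (y t) \<and> b \<le> snd (z t)"
  proof -
    have "continuous_on {l..h} (\<lambda>t. min (snd (y t)) (snd (z t)))"
      by (intro continuous_intros cy cz)
    from continuous_attains_inf[OF _ ne this] obtain t0 where
      "t0 \<in> {l..h}" "\<forall>t\<in>{l..h}. min (snd (y t0)) (snd (z t0)) \<le> min (snd (y t)) (snd (z t))" by auto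
    then show ?thesis using M by (intro that[of "min (snd (y t0)) (snd (z t0))"]) auto
  qed
  obtain c where c: "\<And>t. t \<in> {l..h} \<Longrightarrow> snd (y t) \<le> c \<and> snd (z t) \<le> c"
  proof -
    have "continuous_on {l..h} (\<lambda>t. max (snd (y t)) (snd (z t)))"
      by (intro continuous_intros cy cz)
    from continuous_attains_sup[OF _ ne this] obtain t0 where
      "t0 \<in> {l..h}" "\<forall>t\<in>{l..h}. max (snd (y t)) (snd (z t)) \<le> max (snd (y t0)) (snd (z t0))" by auto
    then show ?thesis by (intro that[of "max (snd (y t0)) (snd (z t0))"]) auto
  qed
  obtain L where L: "0 \<le> L" "\<And>\<rho>1 \<rho>2 r1 r2. \<lbrakk>\<bar>\<rho>1\<bar> \<le> a; \<bar>\<rho>2\<bar> \<le> a; b \<le> r1; r1 \<le> c; b \<le> r2; r2 \<le> c\<rbrakk> \<Longrightarrow>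
      \<bar>fst (toy_field g \<beta> (\<rho>1, r1)) - fst (toy_field g \<beta> (\<rho>2, r2))\<bar> \<le> L * (\<bar>\<rho>1 - \<rho>2\<bar> + \<bar>r1 - r2\<bar>)"
    using toy_field_lipschitz_rectangle[OF g' a(1) b(1)] by metis
  define p q where "p = (\<lambda>t. fst (y t) - fst (z t))" and "q = (\<lambda>t. snd (y t) - snd (z t))"
  define F where "F = (\<lambda>t. fst (toy_field g \<beta> (y t)) - fst (toy_field g \<beta> (z t)))"
  define D where "D = (\<lambda>t. (p t)^2 + (q t)^2)"
  \<comment> \<open>Since r' = \<open>\<rho>\<close>, the derivative of \<open>D\<close> is 2pF +
    2qp. With p^2 and 2|pq| both at most \<open>D\<close>, the first term is bounded by 3L times
    \<open>D\<close> and the second by \<open>D\<close>, which gives the constant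
    \<open>3 * L + 1\<close>.\<close>
  have "D l = 0 \<and> D h = 0"
  proof (rule gronwall_zero[where a=l and b=h and D=D and D'="\<lambda>t. 2 * p t * F t + 2 * q t * p t" and C="3 * L + 1"])
    show "continuous_on {l..h} D"
      unfolding D_def p_def q_def by (intro continuous_intros cy cz)
    show "D l = 0 \<or> D h = 0"
      using eq by (auto simp: l_def h_def D_def p_def q_def min_def max_def)
    fix t assume t: "l < t" "t < h"
    have "(y has_vector_derivative toy_field g \<beta> (y t)) (at t)" "(z has_vector_derivative toy_field g \<beta> (z t)) (at t)"
      using has_vector_derivative_within_subset[OF y(2), of t "{l<..<h}"]
        has_vector_derivative_within_subset[OF z(2), of t "{l<..<h}"] t lh(2)
      by (auto simp: at_within_open[of t "{l<..<h}"] subset_iff)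
    then show "(D has_real_derivative 2 * p t * F t + 2 * q t * p t) (at t)"
      unfolding D_def p_def q_def F_def has_vector_derivative_component_iff
      by (auto intro!: derivative_eq_intros simp: snd_toy_field algebra_simps)
    have tt: "t \<in> {l..h}" using t by auto
    have F: "\<bar>F t\<bar> \<le> L * (\<bar>p t\<bar> + \<bar>q t\<bar>)"
      using L(2)[of "fst (y t)" "fst (z t)" "snd (y t)" "snd (z t)"] a(2)[OF tt] b(2)[OF tt] c[OF tt]
      by (simp add: F_def p_def q_def)
    have pq: "2 * (\<bar>p t\<bar> * \<bar>q t\<bar>) \<le> D t"
      using sum_squares_bound[of "\<bar>p t\<bar>" "\<bar>q t\<bar>"] by (simp add: D_def)
    have pp: "\<bar>p t\<bar> * \<bar>p t\<bar> \<le> D t"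
      by (simp add: D_def flip: power2_eq_square)
    have "\<bar>2 * p t * F t + 2 * q t * p t\<bar> \<le> 2 * \<bar>p t\<bar> * \<bar>F t\<bar> + 2 * \<bar>q t\<bar> * \<bar>p t\<bar>"
      using abs_triangle_ineq[of "2 * p t * F t" "2 * q t * p t"] by (simp add: abs_mult)
    also have "\<dots> \<le> 2 * \<bar>p t\<bar> * (L * (\<bar>p t\<bar> + \<bar>q t\<bar>)) + 2 * \<bar>q t\<bar> * \<bar>p t\<bar>"
      using F by (intro add_mono mult_left_mono) auto
    also have "\<dots> = L * (2 * (\<bar>p t\<bar> * \<bar>p t\<bar>) + 2 * (\<bar>p t\<bar> * \<bar>q t\<bar>)) + 2 * (\<bar>p t\<bar> * \<bar>q t\<bar>)"
      by (simp add: algebra_simps)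
    also have "\<dots> \<le> L * (2 * D t + D t) + D t"
      using pq pp L(1) by (intro add_mono mult_left_mono) auto
    finally show "\<bar>2 * p t * F t + 2 * q t * p t\<bar> \<le> (3 * L + 1) * D t"
      by (simp add: algebra_simps)
  qed (use lh in \<open>auto simp: D_def\<close>)
  then have "D s = 0"
    by (auto simp: l_def h_def min_def max_def split: if_splits)
  then show ?thesis
    by (simp add: D_def p_def q_def sum_power2_eq_zero_iff prod_eq_iff)
qed

section \<open>Translation and continuation of solutions\<close>

lemma toy_solution_shift:
  assumes "toy_solution g \<beta> y I"
  shows "toy_solution g \<beta> (\<lambda>s. y (s + c)) ((\<lambda>s. s - c) ` I)"
  unfolding toy_solution_def
proof clarify
  fix s assume "s \<in> I"
  then have *: "y s \<in> M0" "(y has_vector_derivative toy_field g \<beta> (y s)) (at s)"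
    using assms by (auto simp: toy_solution_def)
  have "((\<lambda>s. y (s + c)) has_vector_derivative toy_field g \<beta> (y s)) (at (s - c))"
    using vector_diff_chain_at[of "\<lambda>s. s + c" 1 "s - c" y] *(2)
    by (simp add: o_def has_vector_derivative_add_const)
  with * show "y (s - c + c) \<in> M0 \<and>
      ((\<lambda>s. y (s + c)) has_vector_derivative toy_field g \<beta> (y (s - c + c))) (at (s - c))"
    by simp
qed

lemma is_interval_shift: "is_interval I \<Longrightarrow> is_interval ((\<lambda>s. s - c) ` I)" for I :: "real set"
  using is_interval_translation[of "-c" I] by simp

lemma open_shift: "open I \<Longrightarrow> open ((\<lambda>s. s - c) ` I)" for I :: "real set"
  using open_translation[of I "-c"] by simp

lemma maximal_toy_solution_shift:
  assumes "maximal_toy_solution g \<beta> y I"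
  shows "maximal_toy_solution g \<beta> (\<lambda>s. y (s + c)) ((\<lambda>s. s - c) ` I)"
  unfolding maximal_toy_solution_def
proof (intro conjI allI impI)
  fix z J assume J: "open J \<and> is_interval J \<and> (\<lambda>s. s - c) ` I \<subseteq> J \<and> toy_solution g \<beta> z J \<and>
    (\<forall>s\<in>(\<lambda>s. s - c) ` I. z s = y (s + c))"
  have "toy_solution g \<beta> (\<lambda>s. z (s + - c)) ((\<lambda>s. s - - c) ` J)"
    using J toy_solution_shift by blast
  moreover have "I \<subseteq> (\<lambda>s. s - - c) ` J"
    using J by force
  moreover have "open ((\<lambda>s. s - - c) ` J)" "is_interval ((\<lambda>s. s - - c) ` J)"
    using J open_shift is_interval_shift by blast+
  ultimately have "(\<lambda>s. s - - c) ` J = I"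
    using assms[unfolded maximal_toy_solution_def, THEN conjunct2, THEN conjunct2, THEN conjunct2,
        THEN conjunct2, rule_format, of "(\<lambda>s. s - - c) ` J" "\<lambda>s. z (s + - c)"] J by auto
  then show "J = (\<lambda>s. s - c) ` I"
    by (auto simp: image_image)
qed (use assms in \<open>auto simp: maximal_toy_solution_def toy_solution_shift open_shift is_interval_shift\<close>)

text \<open>Gluing \<open>y\<close> and \<open>X\<close> along the overlap gives a solution on the
  union, which is an interval because the two intervals meet; maximality then forces the union to be
  \<open>I\<close>. This is how an explicitly known solution is shown to be part of a maximal
  one.\<close>

lemma maximal_toy_solution_absorbs:
  assumes max: "maximal_toy_solution g \<beta> y I"
    and K: "open K" "is_interval K" "I \<inter> K \<noteq> {}"
    and X: "toy_solution g \<beta> X K"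
    and eq: "\<And>s. s \<in> I \<inter> K \<Longrightarrow> X s = y s"
  shows "K \<subseteq> I"
proof -
  define z where "z = (\<lambda>s. if s \<in> I then y s else X s)"
  have I: "open I" "is_interval I" "toy_solution g \<beta> y I"
    using max by (auto simp: maximal_toy_solution_def)
  have zK: "z s = X s" if "s \<in> K" for s
    using that eq by (auto simp: z_def)
  have "is_interval (I \<union> K)"
    using K I by (simp add: is_interval_connected_1 connected_Un)
  moreover have "toy_solution g \<beta> z (I \<union> K)"
    unfolding toy_solution_def
  proof
    fix s assume "s \<in> I \<union> K"
    then show "z s \<in> M0 \<and> (z has_vector_derivative toy_field g \<beta> (z s)) (at s)"
    proof
      assume s: "s \<in> I"
      then have "(z has_vector_derivative toy_field g \<beta> (y s)) (at s)"
        using I has_vector_derivative_transform_within_open[of y _ s I z]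
        by (auto simp: toy_solution_def z_def)
      with s I show ?thesis by (auto simp: toy_solution_def z_def)
    next
      assume s: "s \<in> K"
      then have "(z has_vector_derivative toy_field g \<beta> (X s)) (at s)"
        using X K has_vector_derivative_transform_within_open[of X _ s K z]
        by (auto simp: toy_solution_def zK)
      with s X show ?thesis by (auto simp: toy_solution_def zK)
    qed
  qed
  ultimately have "I \<union> K = I"
    using max K I unfolding maximal_toy_solution_def by (metis (no_types, lifting) Un_upper1 open_Un z_def)
  then show ?thesis by auto
qed

text \<open>The translation by \<open>s2 - s1\<close> makes the common point occur at the same time.
  The two solutions then agree on the intersection of their domains, and each domain absorbs the
  other.\<close>

lemma maximal_toy_solution_same_orbit:
  assumes g': "\<And>x. (g has_real_derivative g' x) (at x)" "continuous_on UNIV g'"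
    and y: "maximal_toy_solution g \<beta> y I" and z: "maximal_toy_solution g \<beta> z J"
    and s: "s1 \<in> I" "s2 \<in> J" "y s1 = z s2"
  shows "y ` I = z ` J"
proof -
  define c where "c = s2 - s1"
  define z' J' where "z' = (\<lambda>s. z (s + c))" and "J' = (\<lambda>s. s - c) ` J"
  have z': "maximal_toy_solution g \<beta> z' J'"
    unfolding z'_def J'_def by (rule maximal_toy_solution_shift[OF z])
  have s1: "s1 \<in> J'" "y s1 = z' s1"
    using s by (auto simp: J'_def z'_def c_def image_iff)
  have eq: "y t = z' t" if "t \<in> I \<inter> J'" for t
  proof (rule toy_solution_unique[OF g', where K="I \<inter> J'" and ?s0.0=s1 and \<beta>=\<beta>])
    show "is_interval (I \<inter> J')"
      using y z' by (auto simp: maximal_toy_solution_def is_interval_Int)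
    show "(y has_vector_derivative toy_field g \<beta> (y s)) (at s within I \<inter> J')" if "s \<in> I \<inter> J'" for s
      using that y by (auto simp: maximal_toy_solution_def toy_solution_def intro: has_vector_derivative_at_within)
    show "(z' has_vector_derivative toy_field g \<beta> (z' s)) (at s within I \<inter> J')" if "s \<in> I \<inter> J'" for s
      using that z' by (auto simp: maximal_toy_solution_def toy_solution_def intro: has_vector_derivative_at_within)
  qed (use that y z' s s1 in \<open>auto simp: maximal_toy_solution_def toy_solution_def\<close>)
  have "J' \<subseteq> I"
    by (rule maximal_toy_solution_absorbs[OF y, where X=z']) (use z' s s1 eq in \<open>auto simp: maximal_toy_solution_def\<close>)
  moreover have "I \<subseteq> J'"
    by (rule maximal_toy_solution_absorbs[OF z', where X=y]) (use y s s1 eq in \<open>auto simp: maximal_toy_solution_def\<close>)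
  ultimately have "y ` I = z' ` J'"
    using eq by (auto simp: image_iff)
  then show ?thesis
    by (simp add: z'_def J'_def image_image)
qed

section \<open>The Briot-Bouquet equation\<close>

text \<open>The disc of radius R - |x| about a real point x lies in the domain, so the Taylor series
  of \<open>f\<close> at x converges there. For real t the powers of t - x are real, and taking real
  parts of the coefficients yields a real series for \<open>G\<close>.\<close>

lemma real_analytic_on_of_holomorphic:
  assumes "f holomorphic_on ball 0 R" "a \<le> R"
    and "\<And>x::real. \<bar>x\<bar> < R \<Longrightarrow> f (of_real x) = of_real (G x)"
  shows "real_analytic_on G {-a<..<a}"
  unfolding real_analytic_on_def
proof
  fix x assume x: "x \<in> {-a<..<a}"
  define d where "d = R - \<bar>x\<bar>"
  define c where "c = (\<lambda>n. (deriv ^^ n) f (of_real x) / fact n)"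
  have d: "d > 0" using x assms(2) by (auto simp: d_def)
  have hol: "f holomorphic_on ball (of_real x) d"
    by (rule holomorphic_on_subset[OF assms(1)]) (auto simp: d_def ball_subset_ball_iff)
  have "(\<lambda>n. Re (c n) * (t - x) ^ n) sums G t" if t: "\<bar>t - x\<bar> < d" for t
  proof -
    have "(of_real t :: complex) \<in> ball (of_real x) d"
      using t by (simp add: dist_norm norm_minus_commute flip: of_real_diff)
    from holomorphic_power_series[OF hol this]
    have "(\<lambda>n. Re (c n * (of_real t - of_real x) ^ n)) sums Re (f (of_real t))"
      unfolding c_def by (rule sums_Re)
    moreover have "f (of_real t) = of_real (G t)"
      using t by (intro assms(3)) (auto simp: d_def)
    ultimately show ?thesis
      by (simp flip: of_real_diff of_real_power)
  qed
  with d show "\<exists>\<delta>>0. \<exists>c. \<forall>t. \<bar>t - x\<bar> < \<delta> \<longrightarrow> (\<lambda>n. c n * (t - x) ^ n) sums G t"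
    by (intro exI[of _ d] conjI exI[of _ "\<lambda>n. Re (c n)"]) auto
qed

text \<open>The fourth power is chosen so that the mean inverts the operator $4 w \frac{d}{dw} + 1$.\<close>

definition quartic_mean :: "(complex \<Rightarrow> complex) \<Rightarrow> complex \<Rightarrow> complex" where
  "quartic_mean f w = integral {0..1} (\<lambda>s::real. f (of_real s ^ 4 * w))"

lemma quartic_in_ball:
  assumes "w \<in> ball (0::complex) R" "s \<in> {0..1::real}"
  shows "of_real s ^ 4 * w \<in> ball 0 R"
proof -
  have "norm (of_real s ^ 4 * w) \<le> 1 * norm w"
    unfolding norm_mult norm_power using assms(2) by (intro mult_right_mono) (auto simp: power_le_one)
  then show ?thesis using assms(1) by simp
qed

lemma continuous_on_quartic:
  assumes "f holomorphic_on ball 0 R" "w \<in> ball 0 R"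
  shows "continuous_on {0..1::real} (\<lambda>s. f (of_real s ^ 4 * w))"
  by (rule continuous_on_compose2[OF holomorphic_on_imp_continuous_on[OF assms(1)]])
    (use quartic_in_ball[OF assms(2)] in \<open>auto intro!: continuous_intros\<close>)

text \<open>The s-derivative of \<open>s * f (s^4 * w)\<close> is
  \<open>f (s^4 * w) + 4 * w * (s^4 * deriv f (s^4 * w))\<close>. Integrated over
  \<open>{0..1}\<close>, the left side gives \<open>f w\<close>; on the right the two terms give the
  mean and, after differentiation under the integral sign, \<open>4 * w\<close> times its
  derivative.\<close>

lemma quartic_mean_has_field_derivative:
  assumes f: "f holomorphic_on ball 0 R" and w: "w \<in> ball 0 R"
  shows "\<exists>D. (quartic_mean f has_field_derivative D) (at w) \<and> 4 * w * D + quartic_mean f w = f w"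
proof -
  let ?U = "ball (0::complex) R"
  define fx where "fx = (\<lambda>x (t::real). deriv f (of_real t ^ 4 * x) * of_real t ^ 4)"
  define D where "D = integral {0..1} (fx w)"
  have df: "(f has_field_derivative deriv f z) (at z)" if "z \<in> ?U" for z
    using f that holomorphic_derivI open_ball by blast
  have cdf: "continuous_on ?U (deriv f)"
    using f by (intro holomorphic_on_imp_continuous_on holomorphic_deriv) auto
  have cfx: "continuous_on (?U \<times> {0..1}) (\<lambda>(x, t). fx x t)"
    unfolding fx_def case_prod_unfold
    by (intro continuous_intros continuous_on_compose2[OF cdf]) (use quartic_in_ball in auto)
  have "((\<lambda>x. integral (cbox 0 1) (\<lambda>s::real. f (of_real s ^ 4 * x))) has_field_derivative
      integral (cbox 0 1) (fx w)) (at w within ?U)"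
  proof (rule leibniz_rule_field_derivative)
    fix x t assume xt: "x \<in> ?U" "t \<in> cbox 0 (1::real)"
    have "((\<lambda>x. f (of_real t ^ 4 * x)) has_field_derivative deriv f (of_real t ^ 4 * x) * (of_real t ^ 4)) (at x)"
      by (rule DERIV_chain2[OF df]) (use xt quartic_in_ball in \<open>auto intro!: derivative_eq_intros\<close>)
    then show "((\<lambda>x. f (of_real t ^ 4 * x)) has_field_derivative fx x t) (at x within ?U)"
      unfolding fx_def by (rule has_field_derivative_at_within)
  next
    fix x assume "x \<in> ?U"
    then show "(\<lambda>s::real. f (of_real s ^ 4 * x)) integrable_on cbox 0 1"
      using integrable_continuous_real[OF continuous_on_quartic[OF f]] by simp
  qed (use cfx w in auto)
  then have D: "(quartic_mean f has_field_derivative D) (at w)"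
    using w by (simp add: quartic_mean_def[abs_def] D_def at_within_open[OF _ open_ball])
  have "((\<lambda>s::real. f (of_real s ^ 4 * w) + 4 * w * fx w s) has_integral
      (of_real 1 * f (of_real 1 ^ 4 * w) - of_real 0 * f (of_real 0 ^ 4 * w))) {0..1}"
  proof (rule fundamental_theorem_of_calculus)
    fix s :: real assume s: "s \<in> {0..1}"
    have "((\<lambda>z. z * f (z ^ 4 * w)) has_field_derivative f (of_real s ^ 4 * w) + 4 * w * fx w s) (at (of_real s))"
      unfolding fx_def
      by (rule derivative_eq_intros DERIV_chain2[OF df] quartic_in_ball[OF w s] refl
          | simp add: algebra_simps power_numeral_reduce)+
    then show "((\<lambda>s. of_real s * f (of_real s ^ 4 * w)) has_vector_derivative
        f (of_real s ^ 4 * w) + 4 * w * fx w s) (at s within {0..1})"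
      by (rule has_vector_derivative_real_field)
  qed simp
  moreover have "continuous_on {0..1} (\<lambda>t. case (w, t) of (x, t) \<Rightarrow> fx x t)"
    by (rule continuous_on_compose2[OF cfx]) (use w in \<open>auto intro!: continuous_intros\<close>)
  then have "fx w integrable_on {0..1}"
    by (intro integrable_continuous_real) simp
  moreover have "(\<lambda>s::real. f (of_real s ^ 4 * w)) integrable_on {0..1}"
    by (rule integrable_continuous_real[OF continuous_on_quartic[OF f w]])
  ultimately have "((\<lambda>s::real. f (of_real s ^ 4 * w) + 4 * w * fx w s) has_integral
      quartic_mean f w + 4 * w * D) {0..1}"
    and "((\<lambda>s::real. f (of_real s ^ 4 * w) + 4 * w * fx w s) has_integral f w) {0..1}"
    unfolding quartic_mean_def D_def
    by (auto intro!: has_integral_add has_integral_mult_right integrable_integral)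
  then have "quartic_mean f w + 4 * w * D = f w"
    by (rule has_integral_unique)
  with D show ?thesis
    by (auto simp: add.commute)
qed

lemma quartic_mean_holomorphic:
  assumes "f holomorphic_on ball 0 R"
  shows "quartic_mean f holomorphic_on ball 0 R"
  using quartic_mean_has_field_derivative[OF assms] by (force simp: holomorphic_on_open)

lemma norm_quartic_mean_diff_le:
  assumes f: "f holomorphic_on ball 0 R" and g: "g holomorphic_on ball 0 R" and w: "w \<in> ball 0 R"
    and "\<And>z. z \<in> ball 0 R \<Longrightarrow> norm (f z - g z) \<le> e"
  shows "norm (quartic_mean f w - quartic_mean g w) \<le> e"
proof -
  have "quartic_mean f w - quartic_mean g w = integral {0..1} (\<lambda>s::real. f (of_real s ^ 4 * w) - g (of_real s ^ 4 * w))"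
    unfolding quartic_mean_def
    by (rule integral_diff[symmetric]) (intro integrable_continuous_real continuous_on_quartic[OF _ w] f g)+
  also have "norm \<dots> \<le> e * (1 - 0)"
    by (rule integral_bound)
      (use assms(4) quartic_in_ball[OF w] in \<open>auto intro!: continuous_intros continuous_on_quartic[OF f w] continuous_on_quartic[OF g w]\<close>)
  finally show ?thesis by simp
qed

lemma quartic_mean_real:
  assumes f: "f holomorphic_on ball 0 R" and w: "w \<in> ball 0 R" "w \<in> \<real>"
    and real: "\<And>z. z \<in> ball 0 R \<Longrightarrow> z \<in> \<real> \<Longrightarrow> f z \<in> \<real>"
  shows "quartic_mean f w \<in> \<real>"
proof -
  have "((\<lambda>s::real. f (of_real s ^ 4 * w)) has_integral quartic_mean f w) {0..1}"
    unfolding quartic_mean_def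
    by (intro integrable_integral integrable_continuous_real continuous_on_quartic[OF f w(1)])
  then have "((\<lambda>s::real. Im (f (of_real s ^ 4 * w))) has_integral Im (quartic_mean f w)) {0..1}"
    by (rule has_integral_Im)
  moreover have "((\<lambda>s::real. Im (f (of_real s ^ 4 * w))) has_integral 0) {0..1}"
    by (rule has_integral_is_0)
      (use real quartic_in_ball[OF w(1)] w(2) in \<open>auto simp: complex_is_Real_iff[symmetric]\<close>)
  ultimately show ?thesis
    using has_integral_unique complex_is_Real_iff by blast
qed

section \<open>Fixed point of the singular equation\<close>

text \<open>The factor 2 in \<open>T\<close> and the Lipschitz constant 1/8 give contraction by 1/4.
  The same constants keep the \<epsilon>-ball invariant: F is bounded by \<epsilon>/8 + \<epsilon>/8
  on it, so \<open>T u\<close> is bounded by \<epsilon>/2. Holomorphy, the bound and realness on the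
  real axis are preserved by \<open>T\<close> and pass to the uniform limit of the iterates started
  at 0.\<close>

lemma briot_bouquet_contraction:
  fixes F :: "complex \<Rightarrow> complex \<Rightarrow> complex" and \<epsilon> R :: real
  assumes \<epsilon>: "\<epsilon> \<ge> 0"
    and hol: "\<And>u. u holomorphic_on ball 0 R \<Longrightarrow> (\<And>w. w \<in> ball 0 R \<Longrightarrow> norm (u w) \<le> \<epsilon>) \<Longrightarrow>
      (\<lambda>w. F (u w) w) holomorphic_on ball 0 R"
    and lip: "\<And>u v w. norm u \<le> \<epsilon> \<Longrightarrow> norm v \<le> \<epsilon> \<Longrightarrow> w \<in> ball 0 R \<Longrightarrow> norm (F u w - F v w) \<le> norm (u - v) / 8"
    and zero: "\<And>w. w \<in> ball 0 R \<Longrightarrow> norm (F 0 w) \<le> \<epsilon> / 8"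
    and real: "\<And>u w. norm u \<le> \<epsilon> \<Longrightarrow> w \<in> ball 0 R \<Longrightarrow> u \<in> \<real> \<Longrightarrow> w \<in> \<real> \<Longrightarrow> F u w \<in> \<real>"
  obtains u where "u holomorphic_on ball 0 R" "\<And>w. w \<in> ball 0 R \<Longrightarrow> norm (u w) \<le> \<epsilon>"
    "\<And>w. w \<in> ball 0 R \<Longrightarrow> w \<in> \<real> \<Longrightarrow> u w \<in> \<real>"
    "\<And>w. w \<in> ball 0 R \<Longrightarrow> 4 * w * deriv u w + u w = 2 * F (u w) w"
proof -
  let ?U = "ball (0::complex) R"
  define T where "T = (\<lambda>u w. 2 * quartic_mean (\<lambda>z. F (u z) z) w)"
  define P where "P = (\<lambda>u. u holomorphic_on ?U \<and> (\<forall>w\<in>?U. norm (u w) \<le> \<epsilon> \<and> (w \<in> \<real> \<longrightarrow> u w \<in> \<real>)))"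
  have Tdiff: "norm (T u w - T v w) \<le> e / 4"
    if "P u" "P v" "w \<in> ?U" "\<And>z. z \<in> ?U \<Longrightarrow> norm (u z - v z) \<le> e" for u v w e
  proof -
    have "norm (quartic_mean (\<lambda>z. F (u z) z) w - quartic_mean (\<lambda>z. F (v z) z) w) \<le> e / 8"
    proof (rule norm_quartic_mean_diff_le[OF hol hol])
      fix z assume z: "z \<in> ?U"
      then have "norm (F (u z) z - F (v z) z) \<le> norm (u z - v z) / 8"
        using that by (intro lip) (auto simp: P_def)
      then show "norm (F (u z) z - F (v z) z) \<le> e / 8"
        using that(4)[OF z] by simp
    qed (use that in \<open>auto simp: P_def\<close>)
    then show ?thesis
      unfolding T_def right_diff_distrib[symmetric] norm_mult by simp
  qed
  have PT: "P (T u)" if u: "P u" for u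
    unfolding P_def
  proof (intro conjI ballI impI)
    have hu: "(\<lambda>w. F (u w) w) holomorphic_on ?U"
      using u by (intro hol) (auto simp: P_def)
    show "T u holomorphic_on ?U"
      unfolding T_def by (intro holomorphic_intros quartic_mean_holomorphic hu)
    fix w assume w: "w \<in> ?U"
    have "norm (F (u z) z - 0) \<le> \<epsilon> / 4" if z: "z \<in> ?U" for z
    proof -
      have uz: "norm (u z) \<le> \<epsilon>" using u z by (auto simp: P_def)
      have "norm (F (u z) z) \<le> norm (F (u z) z - F 0 z) + norm (F 0 z)"
        by (metis add.commute norm_triangle_sub)
      also have "\<dots> \<le> norm (u z - 0) / 8 + \<epsilon> / 8"
        using uz \<epsilon> z by (intro add_mono lip zero) auto
      finally show ?thesis using uz by simp
    qed
    from norm_quartic_mean_diff_le[OF hu holomorphic_on_const w this]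
    have "norm (quartic_mean (\<lambda>w. F (u w) w) w) \<le> \<epsilon> / 4"
      by (simp add: quartic_mean_def)
    then show "norm (T u w) \<le> \<epsilon>"
      using \<epsilon> by (simp add: T_def norm_mult)
    assume "w \<in> \<real>"
    then show "T u w \<in> \<real>"
      unfolding T_def using w u
      by (intro Reals_mult quartic_mean_real[OF hu] real) (auto simp: P_def)
  qed
  define V where "V = (\<lambda>n. (T ^^ n) (\<lambda>_. 0))"
  have V_Suc: "V (Suc n) = T (V n)" for n
    by (simp add: V_def)
  have PV: "P (V n)" for n
    by (induction n) (auto simp: V_Suc PT, auto simp: V_def P_def \<epsilon>)
  have step: "norm (V (Suc n) w - V n w) \<le> \<epsilon> * (1/4) ^ n" if "w \<in> ?U" for n w
    using that
  proof (induction n arbitrary: w)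
    case 0
    then show ?case using PV[of 1] by (auto simp: V_def P_def)
  next
    case (Suc n)
    from Tdiff[OF PV PV Suc.prems Suc.IH] show ?case
      by (simp add: V_Suc[symmetric])
  qed
  \<comment> \<open>The iterates are the partial sums of this telescoping series because
    \<open>V 0\<close> is zero, so the geometric bound \<open>step\<close> gives uniform
    convergence.\<close>
  define u where "u = (\<lambda>w. \<Sum>i. V (Suc i) w - V i w)"
  have "uniform_limit ?U (\<lambda>n w. \<Sum>i<n. V (Suc i) w - V i w) u sequentially"
    unfolding u_def
    by (rule Weierstrass_m_test[where M="\<lambda>n. \<epsilon> * (1/4) ^ n"]) (auto simp: step intro!: summable_mult)
  then have lim: "uniform_limit ?U V u sequentially"
    using sum_lessThan_telescope[of "\<lambda>i. V i w" for w] by (simp add: V_def)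
  have limw: "(\<lambda>n. V n w) \<longlonglongrightarrow> u w" if "w \<in> ?U" for w
    using tendsto_uniform_limitI[OF lim that] .
  have hu: "u holomorphic_on ?U"
  proof (rule holomorphic_uniform_sequence[where f=V])
    fix x assume "x \<in> ?U"
    then obtain d where "d > 0" "cball x d \<subseteq> ?U"
      using open_contains_cball[of ?U] open_ball by blast
    then show "\<exists>d>0. cball x d \<subseteq> ?U \<and> uniform_limit (cball x d) V u sequentially"
      using uniform_limit_on_subset[OF lim] by blast
  qed (use PV in \<open>auto simp: P_def\<close>)
  have nu: "norm (u w) \<le> \<epsilon>" if "w \<in> ?U" for w
    by (rule Lim_norm_ubound[OF _ limw[OF that]]) (use PV that in \<open>auto simp: P_def\<close>)
  have ru: "u w \<in> \<real>" if "w \<in> ?U" "w \<in> \<real>" for w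
    by (rule closed_sequentially[OF closed_complex_Reals _ limw[OF that(1)]]) (use PV that in \<open>auto simp: P_def\<close>)
  have Pu: "P u" using hu nu ru by (auto simp: P_def)
  have fixpoint: "u w = T u w" if w: "w \<in> ?U" for w
  proof -
    have "norm (T u w - u w) \<le> 2 * e" if e: "e > 0" for e
    proof -
      obtain N where N: "\<And>n z. n \<ge> N \<Longrightarrow> z \<in> ?U \<Longrightarrow> norm (V n z - u z) < e"
        using lim e unfolding uniform_limit_iff eventually_sequentially dist_norm by metis
      have "norm (T u w - T (V N) w) \<le> e / 4"
        using N[of N] by (intro Tdiff Pu PV w) (auto simp: norm_minus_commute less_imp_le)
      moreover have "norm (T (V N) w - u w) < e"
        using N[of "Suc N" w] w by (simp add: V_Suc)
      ultimately show ?thesis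
        using norm_triangle_ineq[of "T u w - T (V N) w" "T (V N) w - u w"] e by simp
    qed
    \<comment> \<open>With this choice of \<open>e\<close> the bound says that the norm is at most
      half of itself.\<close>
    from this[of "norm (T u w - u w) / 4"] have "norm (T u w - u w) = 0"
      by (cases "norm (T u w - u w) > 0") auto
    then show ?thesis by simp
  qed
  have "4 * w * deriv u w + u w = 2 * F (u w) w" if w: "w \<in> ?U" for w
  proof -
    have "(\<lambda>w. F (u w) w) holomorphic_on ?U"
      using hu nu by (intro hol) auto
    from quartic_mean_has_field_derivative[OF this w] obtain D where
      D: "(quartic_mean (\<lambda>w. F (u w) w) has_field_derivative D) (at w)"
        "4 * w * D + quartic_mean (\<lambda>w. F (u w) w) w = F (u w) w" by blast
    have "(T u has_field_derivative 2 * D) (at w)"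
      unfolding T_def by (rule DERIV_cmult[OF D(1)])
    then have "(u has_field_derivative 2 * D) (at w)"
      by (rule has_field_derivative_transform_within_open[OF _ open_ball w]) (simp add: fixpoint)
    then have "deriv u w = 2 * D"
      by (rule DERIV_imp_deriv)
    moreover have "u w = 2 * quartic_mean (\<lambda>w. F (u w) w) w"
      using fixpoint[OF w] by (simp add: T_def)
    ultimately have "4 * w * deriv u w + u w = 2 * (4 * w * D + quartic_mean (\<lambda>w. F (u w) w) w)"
      by (simp add: algebra_simps)
    then show ?thesis
      unfolding D(2) .
  qed
  with hu nu ru show ?thesis
    using that by blast
qed

section \<open>The holomorphic graph through the equilibrium\<close>

text \<open>The Taylor series of \<open>g\<close> at 0 is evaluated at complex arguments. It
  converges at z because it converges at some real t with |z| < t < \<delta>.\<close>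

lemma real_analytic_complex_extension:
  assumes "real_analytic_on g UNIV"
  obtains \<delta> gc where "\<delta> > 0" "gc holomorphic_on ball 0 \<delta>"
    "\<And>x::real. \<bar>x\<bar> < \<delta> \<Longrightarrow> gc (of_real x) = of_real (g x)"
proof -
  obtain \<delta> c where \<delta>: "\<delta> > 0" and c: "\<And>t. \<bar>t\<bar> < \<delta> \<Longrightarrow> (\<lambda>n. c n * t ^ n) sums g t"
    using assms unfolding real_analytic_on_def by (metis UNIV_I diff_zero)
  define gc where "gc = (\<lambda>z::complex. \<Sum>n. of_real (c n) * z ^ n)"
  have summ: "summable (\<lambda>n. of_real (c n) * z ^ n)" if z: "norm z < \<delta>" for z :: complex
  proof -
    obtain t where t: "norm z < t" "t < \<delta>"
      using dense z by blast
    then have "\<bar>t\<bar> < \<delta>" "norm z < \<bar>t\<bar>" using norm_ge_zero[of z] by linarith+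
    then have "summable (\<lambda>n. of_real (c n * t ^ n) :: complex)"
      using c[of t] by (intro summable_of_real) (auto simp: sums_iff)
    then show ?thesis
      using powser_inside[of "\<lambda>n. of_real (c n)" "of_real t :: complex" z] \<open>norm z < \<bar>t\<bar>\<close> by simp
  qed
  show ?thesis
  proof (rule that[OF \<delta>])
    show "gc holomorphic_on ball 0 \<delta>"
      by (rule power_series_holomorphic[where a="\<lambda>n. of_real (c n)"])
        (use summ in \<open>auto simp: gc_def sums_iff\<close>)
    fix x :: real assume x: "\<bar>x\<bar> < \<delta>"
    have "(\<lambda>n. of_real (c n * x ^ n) :: complex) sums of_real (g x)"
      using c[OF x] by (rule sums_of_real)
    then show "gc (of_real x) = of_real (g x)"
      by (simp add: gc_def sums_iff)
  qed
qed

lemma isCont_eventually_less: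
  fixes f :: "'a::t2_space \<Rightarrow> real"
  assumes "isCont f a" "f a < c"
  shows "\<forall>\<^sub>F x in nhds a. f x < c"
  using assms by (intro order_tendstoD) (simp add: isCont_def tendsto_at_iff_tendsto_nhds)

text \<open>The last conclusion is the orbit equation with w as parameter, d\<eta>/dt = 2 w
  d\<eta>/dw; it holds for negative x as well, where \<open>H\<close> continues the orbit
  analytically. The bound by 1/2 keeps 1 - h^2 w off the branch cut, so that its square root, the
  future \<rho>, is holomorphic too.\<close>

lemma ew_field_holomorphic_graph:
  assumes "real_analytic_on g UNIV"
  obtains R h H where "R > 0" "h holomorphic_on ball 0 R"
    "\<And>x. \<bar>x\<bar> < R \<Longrightarrow> h (of_real x) = of_real (H x)"
    "\<And>w. w \<in> ball 0 R \<Longrightarrow> norm (h w ^ 2 * w) < 1/2"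
    "H 0 = 1/3"
    "\<And>x. \<bar>x\<bar> < R \<Longrightarrow> \<exists>D. (H has_real_derivative D) (at x) \<and> 2 * x * D = fst (ew_field g \<beta> (H x, x))"
proof -
  obtain \<delta> gc where \<delta>: "\<delta> > 0" and gc: "gc holomorphic_on ball 0 \<delta>"
    "\<And>x::real. \<bar>x\<bar> < \<delta> \<Longrightarrow> gc (of_real x) = of_real (g x)"
    using real_analytic_complex_extension[OF assms] by blast
  have cgc: "isCont gc 0"
    using gc(1) \<delta> holomorphic_on_imp_continuous_on continuous_on_eq_continuous_at[OF open_ball]
    by (metis centre_in_ball)
  define b where "b = complex_of_real \<beta>"
  define E where "E = (\<lambda>\<eta> w. \<eta> / 2 * (1 - 3 * \<eta> * csqrt (1 - \<eta>^2 * w)) - 3/2 * b * \<eta>^2 * w * gc w)"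
  \<comment> \<open>\<open>K\<close> is the \<eta>-derivative of \<open>E\<close> plus 1/2, that is,
    the u-derivative of \<open>F\<close> at \<eta> = 1/3 + u. It vanishes at (1/3, 0), hence is
    below 1/8 nearby.\<close>
  define K where "K = (\<lambda>\<eta> w. 1 - 3 * \<eta> * csqrt (1 - \<eta>^2 * w)
    + 3/2 * \<eta>^3 * w / csqrt (1 - \<eta>^2 * w) - 3 * b * \<eta> * w * gc w)"
  define F where "F = (\<lambda>u w. E (1/3 + u) w + u / 2)"
  have np: "1 - z \<notin> \<real>\<^sub>\<le>\<^sub>0" if "norm z < 1/2" for z :: complex
    using that complex_Re_le_cmod[of z] by (auto simp: complex_nonpos_Reals_iff)
  have cp: "isCont (\<lambda>p. gc (snd p)) (\<eta>, 0)" for \<eta> :: complex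
    by (rule isCont_o2[where g=gc]) (use cgc in auto)
  have "isCont (\<lambda>p. norm (K (fst p) (snd p))) (1/3, 0)"
    unfolding K_def by (intro continuous_intros cp isCont_csqrt') auto
  then have K1: "\<forall>\<^sub>F p in nhds (1/3, 0). norm (K (fst p) (snd p)) < 1/8"
    by (rule isCont_eventually_less) (simp add: K_def)
  have "isCont (\<lambda>p::complex \<times> complex. norm (fst p ^ 2 * snd p)) (1/3, 0)"
    by (intro continuous_intros)
  then have K2: "\<forall>\<^sub>F p::complex \<times> complex in nhds (1/3, 0). norm (fst p ^ 2 * snd p) < 1/2"
    by (rule isCont_eventually_less) simp
  from eventually_conj[OF K1 K2] obtain d where d: "d > 0"
    and dK: "\<And>\<eta> w. dist (\<eta>, w) (1/3, 0) < d \<Longrightarrow> norm (K \<eta> w) < 1/8 \<and> norm (\<eta>^2 * w) < 1/2"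
    unfolding eventually_nhds_metric by (metis fst_conv snd_conv)
  \<comment> \<open>The bound d/3, imposed on u here and on w through \<open>R\<close>, keeps (1/3 +
    u, w) within distance d of the equilibrium; 1/6 keeps 1/3 + u positive.\<close>
  define \<epsilon> where "\<epsilon> = min (d/3) (1/6)"
  have \<epsilon>: "\<epsilon> > 0" using d by (simp add: \<epsilon>_def)
  have "isCont (\<lambda>w. norm (F 0 w)) 0"
    unfolding F_def E_def by (intro continuous_intros cgc isCont_csqrt') auto
  then have "\<forall>\<^sub>F w in nhds 0. norm (F 0 w) < \<epsilon> / 8"
    by (rule isCont_eventually_less) (use \<epsilon> in \<open>simp add: F_def E_def\<close>)
  then obtain e where e: "e > 0" and eF: "\<And>w. norm w < e \<Longrightarrow> norm (F 0 w) < \<epsilon> / 8"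
    unfolding eventually_nhds_metric by (auto simp: dist_norm)
  define R where "R = min \<delta> (min (d/3) e)"
  have R: "R > 0" "R \<le> \<delta>" "R \<le> d/3" "R \<le> e" using \<delta> d e by (auto simp: R_def)
  have near: "norm (K (1/3 + u) w) < 1/8" "norm ((1/3 + u)^2 * w) < 1/2"
    if "norm u \<le> \<epsilon>" "w \<in> ball 0 R" for u w
  proof -
    have "dist (1/3 + u, w) (1/3, 0) = sqrt ((norm u)^2 + (norm w)^2)"
      by (simp add: dist_norm norm_Pair)
    also have "\<dots> \<le> norm u + norm w"
      by (rule sqrt_sum_squares_le_sum) auto
    also have "\<dots> < d"
      using that R d by (auto simp: \<epsilon>_def)
    finally show "norm (K (1/3 + u) w) < 1/8" "norm ((1/3 + u)^2 * w) < 1/2"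
      using dK by auto
  qed
  have gR: "gc holomorphic_on ball 0 R"
    using gc(1) by (rule holomorphic_on_subset) (use R in auto)
  have real_F: "F (of_real u) (of_real w) = of_real (fst (ew_field g \<beta> (1/3 + u, w)) + u / 2)"
    if "norm (complex_of_real u) \<le> \<epsilon>" "complex_of_real w \<in> ball 0 R" for u w
  proof -
    have "norm (of_real ((1/3 + u)^2 * w) :: complex) < 1/2"
      using near(2)[OF that] by simp
    then have "\<bar>(1/3 + u)^2 * w\<bar> < 1/2"
      unfolding norm_of_real .
    then have "0 \<le> 1 - (1/3 + u)^2 * w"
      by linarith
    then have "csqrt (of_real (1 - (1/3 + u)^2 * w)) = of_real (sqrt (1 - (1/3 + u)^2 * w))"
      by (simp add: csqrt_of_real_nonneg)
    moreover have "gc (of_real w) = of_real (g w)"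
      using that R by (intro gc(2)) auto
    ultimately show ?thesis
      unfolding F_def E_def ew_field_def b_def Let_def by simp
  qed
  obtain u where u: "u holomorphic_on ball 0 R" "\<And>w. w \<in> ball 0 R \<Longrightarrow> norm (u w) \<le> \<epsilon>"
    "\<And>w. w \<in> ball 0 R \<Longrightarrow> w \<in> \<real> \<Longrightarrow> u w \<in> \<real>"
    "\<And>w. w \<in> ball 0 R \<Longrightarrow> 4 * w * deriv u w + u w = 2 * F (u w) w"
  proof (rule briot_bouquet_contraction[of \<epsilon> R F])
    fix u :: "complex \<Rightarrow> complex" assume u: "u holomorphic_on ball 0 R" "\<And>w. w \<in> ball 0 R \<Longrightarrow> norm (u w) \<le> \<epsilon>"
    show "(\<lambda>w. F (u w) w) holomorphic_on ball 0 R"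
      unfolding F_def E_def
      by (intro holomorphic_intros u gR np near(2)) (use u in auto)
  next
    fix u v w :: complex assume uvw: "norm u \<le> \<epsilon>" "norm v \<le> \<epsilon>" "w \<in> ball 0 R"
    have "norm (F u w - F v w) \<le> 1/8 * norm (u - v)"
    proof (rule field_differentiable_bound[where S="cball 0 \<epsilon>" and f'="\<lambda>u. K (1/3 + u) w"])
      fix z :: complex assume "z \<in> cball 0 \<epsilon>"
      then have z: "norm z \<le> \<epsilon>" by simp
      define s where "s = csqrt (1 - (1/3 + z)^2 * w)"
      have nz: "1 - (1/3 + z)^2 * w \<notin> \<real>\<^sub>\<le>\<^sub>0"
        using np near(2)[OF z uvw(3)] by blast
      then have s0: "s \<noteq> 0" by (auto simp: s_def)
      have S: "((\<lambda>z. csqrt (1 - (1/3 + z)^2 * w)) has_field_derivative - (1/3 + z) * w / s) (at z)"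
      proof -
        have "((\<lambda>z. 1 - (1/3 + z)^2 * w) has_field_derivative - (2 * (1/3 + z) * w)) (at z)"
          by (auto intro!: derivative_eq_intros)
        then have "((\<lambda>z. csqrt (1 - (1/3 + z)^2 * w)) has_field_derivative - (2 * (1/3 + z) * w) / (2 * s)) (at z)"
          unfolding s_def by (rule has_field_derivative_csqrt') (rule nz)
        moreover have "- (2 * (1/3 + z) * w) / (2 * s) = - (1/3 + z) * w / s"
          using s0 by (simp add: field_simps)
        ultimately show ?thesis by simp
      qed
      have "((\<lambda>u. (1/3 + u) / 2 * (1 - 3 * (1/3 + u) * Q u) - 3/2 * b * (1/3 + u)^2 * w * gc w + u / 2)
          has_field_derivative (1 - 3 * (1/3 + z) * Q z) / 2 - 3 * (1/3 + z) / 2 * (Q z + (1/3 + z) * Q')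
            - 3 * b * (1/3 + z) * w * gc w + 1/2) (at z)"
        if "(Q has_field_derivative Q') (at z)" for Q Q'
        using that by (auto intro!: derivative_eq_intros simp: field_simps)
      from this[OF S] have "((\<lambda>u. F u w) has_field_derivative
          (1 - 3 * (1/3 + z) * s) / 2 - 3 * (1/3 + z) / 2 * (s + (1/3 + z) * (- (1/3 + z) * w / s))
            - 3 * b * (1/3 + z) * w * gc w + 1/2) (at z)"
        unfolding F_def E_def s_def .
      also have "(1 - 3 * (1/3 + z) * s) / 2 - 3 * (1/3 + z) / 2 * (s + (1/3 + z) * (- (1/3 + z) * w / s))
            - 3 * b * (1/3 + z) * w * gc w + 1/2 = K (1/3 + z) w"
        unfolding K_def s_def[symmetric] using s0
        by (simp add: field_simps power2_eq_square power3_eq_cube)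
      finally show "((\<lambda>u. F u w) has_field_derivative K (1/3 + z) w) (at z within cball 0 \<epsilon>)"
        by (rule has_field_derivative_at_within)
      show "norm (K (1/3 + z) w) \<le> 1/8"
        using near(1)[OF z uvw(3)] by simp
    qed (use uvw in auto)
    then show "norm (F u w - F v w) \<le> norm (u - v) / 8" by simp
  next
    fix w assume "w \<in> ball (0::complex) R"
    then show "norm (F 0 w) \<le> \<epsilon> / 8"
      using eF[of w] R by auto
  next
    fix u w :: complex assume "norm u \<le> \<epsilon>" "w \<in> ball 0 R" "u \<in> \<real>" "w \<in> \<real>"
    then show "F u w \<in> \<real>"
      by (auto elim!: Reals_cases simp: real_F)
  qed (use \<epsilon> in auto)
  define h where "h = (\<lambda>w. 1/3 + u w)"
  define U where "U = (\<lambda>x. Re (u (of_real x)))"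
  have inb: "complex_of_real x \<in> ball 0 R" if "\<bar>x\<bar> < R" for x
    using that by simp
  have uU: "u (of_real x) = of_real (U x)" if "\<bar>x\<bar> < R" for x
    using u(3)[OF inb[OF that]] by (simp add: U_def of_real_Re)
  have U\<epsilon>: "\<bar>U x\<bar> \<le> \<epsilon>" if "\<bar>x\<bar> < R" for x
    using u(2)[OF inb[OF that]] uU[OF that] by simp
  \<comment> \<open>The u/2 added in the definition of \<open>F\<close> cancels against the isolated
    u of the fixed-point equation and leaves the original field.\<close>
  have ode: "4 * x * Re (deriv u (of_real x)) = 2 * fst (ew_field g \<beta> (1/3 + U x, x))" if x: "\<bar>x\<bar> < R" for x
  proof -
    have "4 * of_real x * deriv u (of_real x) + of_real (U x) =
        2 * of_real (fst (ew_field g \<beta> (1/3 + U x, x)) + U x / 2)"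
      using u(4)[OF inb[OF x]] real_F[of "U x" x] u(2)[OF inb[OF x]] inb[OF x]
      unfolding uU[OF x] by simp
    then have "Re (4 * of_real x * deriv u (of_real x) + of_real (U x)) =
        Re (2 * of_real (fst (ew_field g \<beta> (1/3 + U x, x)) + U x / 2))"
      by (rule arg_cong)
    then show ?thesis by simp
  qed
  show ?thesis
  proof (rule that[of R h "\<lambda>x. 1/3 + U x"])
    show "R > 0" by (rule R)
    show "h holomorphic_on ball 0 R"
      unfolding h_def by (intro holomorphic_intros u)
    show "h (of_real x) = of_real (1/3 + U x)" if "\<bar>x\<bar> < R" for x
      using uU[OF that] by (simp add: h_def)
    show "norm (h w ^ 2 * w) < 1/2" if "w \<in> ball 0 R" for w
      using near(2)[OF u(2)[OF that] that] by (simp add: h_def)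
    have pos: "1/3 + U x > 0" if "\<bar>x\<bar> < R" for x
      using U\<epsilon>[OF that] by (auto simp: \<epsilon>_def)
    \<comment> \<open>At w = 0 the differential equation degenerates to the equilibrium condition,
      with roots \<eta> = 0 and \<eta> = 1/3; positivity excludes the first.\<close>
    have "(1/3 + U 0) / 2 * (1 - 3 * (1/3 + U 0)) = 0"
      using ode[of 0] R by (auto simp: ew_field_def Let_def)
    then show "1/3 + U 0 = 1/3"
      using pos[of 0] R by auto
    fix x assume x: "\<bar>x\<bar> < R"
    have "(u has_field_derivative deriv u (of_real x)) (at (of_real x))"
      using u(1) inb[OF x] holomorphic_derivI open_ball by blast
    then have "((\<lambda>x. u (of_real x)) has_vector_derivative deriv u (of_real x)) (at x)"
      by (rule has_vector_derivative_real_field)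
    then have "(U has_real_derivative Re (deriv u (of_real x))) (at x)"
      unfolding U_def has_real_derivative_iff_has_vector_derivative
      by (rule bounded_linear.has_vector_derivative[OF bounded_linear_Re])
    then have "((\<lambda>x. 1/3 + U x) has_real_derivative Re (deriv u (of_real x))) (at x)"
      by (auto intro!: derivative_eq_intros)
    then show "\<exists>D. ((\<lambda>x. 1/3 + U x) has_real_derivative D) (at x) \<and>
        2 * x * D = fst (ew_field g \<beta> (1/3 + U x, x))"
      using ode[OF x] by (intro exI[of _ "Re (deriv u (of_real x))"]) auto
  qed
qed

section \<open>The change of coordinates and the unstable manifold\<close>

text \<open>The inverse of \<open>Phi\<close> as a map from \<open>M1\<close> to \<open>N0\<close>;
  the nonnegative root is the right one because \<rho> > 0 on \<open>M1\<close>.\<close>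

definition Psi :: "real \<times> real \<Rightarrow> real \<times> real" where
  "Psi p = (sqrt (1 - (fst p)^2 * snd p), sqrt (snd p))"

lemma M1_subset_M0: "M1 \<subseteq> M0"
  by (auto simp: M0_def M1_def)

lemma N0_subset_N1: "N0 \<subseteq> N1"
  by (auto simp: N0_def)

lemma Phi_in_N0:
  assumes "y \<in> M1" shows "Phi y \<in> N0"
proof -
  have *: "0 < fst y" "fst y < 1" "0 < snd y" using assms by (auto simp: M1_def)
  then have "(fst y)^2 < 1" by (simp add: abs_square_less_1)
  with * show ?thesis
    by (auto simp: N0_def N1_def Phi_def power_divide)
qed

lemma Psi_Phi:
  assumes "y \<in> M1" shows "Psi (Phi y) = y"
proof -
  have *: "0 < fst y" "fst y < 1" "0 < snd y" using assms by (auto simp: M1_def)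
  then have "(fst y)^2 < 1" by (simp add: abs_square_less_1)
  with * show ?thesis
    by (auto simp: Psi_def Phi_def power_divide prod_eq_iff)
qed

lemma Psi_in_M1:
  assumes "p \<in> N0" shows "Psi p \<in> M1"
proof -
  have *: "0 < fst p" "(fst p)^2 * snd p < 1" "0 < snd p" using assms by (auto simp: N0_def N1_def)
  then have "0 < (fst p)^2 * snd p" by simp
  with * show ?thesis
    by (auto simp: M1_def Psi_def)
qed

lemma Phi_Psi:
  assumes "p \<in> N0" shows "Phi (Psi p) = p"
proof -
  have *: "0 < fst p" "(fst p)^2 * snd p < 1" "0 < snd p" using assms by (auto simp: N0_def N1_def)
  then show ?thesis
    by (auto simp: Phi_def Psi_def prod_eq_iff real_sqrt_mult)
qed

section \<open>Transport of the vector fields and change of time\<close>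

text \<open>The scalar factor is dt/ds: from w = r^2 and dw/dt = 2w the new time is t = ln r +
  const, so dt/ds = \<rho>/r. With q = sqrt (1 - \<rho>^2) one has \<eta> = q/r and \<eta>^2 w =
  q^2, so the square root in the (\<eta>, w)-field is \<rho> itself.\<close>

lemma Phi_has_vector_derivative:
  assumes y: "y s \<in> M1" and der: "(y has_vector_derivative toy_field g \<beta> (y s)) (at s)"
  shows "((\<lambda>s. Phi (y s)) has_vector_derivative (fst (y s) / snd (y s)) *\<^sub>R ew_field g \<beta> (Phi (y s))) (at s)"
proof -
  define \<rho> r q where "\<rho> = fst (y s)" and "r = snd (y s)" and "q = sqrt (1 - \<rho>^2)"
  have *: "0 < \<rho>" "\<rho> < 1" "0 < r" using y by (auto simp: M1_def \<rho>_def r_def)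
  then have "\<rho>^2 < 1" by (simp add: abs_square_less_1)
  then have q: "q > 0" "1 - \<rho>^2 = q^2" by (auto simp: q_def)
  then have s\<rho>: "sqrt (1 - q^2) = \<rho>" using * by (simp flip: q(2))
  define \<rho>' where "\<rho>' = 3/2 * q^2 / r * (-1 + q * (\<beta> * r^2 * g (r^2) + \<rho>) / r)"
  have d: "((\<lambda>s. fst (y s)) has_real_derivative \<rho>') (at s)" "((\<lambda>s. snd (y s)) has_real_derivative \<rho>) (at s)"
  proof -
    have "toy_field g \<beta> (y s) = (\<rho>', \<rho>)"
      unfolding \<rho>'_def q(2)[symmetric] unfolding toy_field_def Let_def q_def \<rho>_def r_def ..
    then show "((\<lambda>s. fst (y s)) has_real_derivative \<rho>') (at s)" "((\<lambda>s. snd (y s)) has_real_derivative \<rho>) (at s)"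
      using der unfolding has_vector_derivative_component_iff by auto
  qed
  have dq: "((\<lambda>s. sqrt (1 - (fst (y s))^2)) has_real_derivative - \<rho> * \<rho>' / q) (at s)"
    using \<open>\<rho>^2 < 1\<close> d(1) by (auto intro!: derivative_eq_intros simp: \<rho>_def q_def field_simps)
  have "((\<lambda>s. sqrt (1 - (fst (y s))^2) / snd (y s)) has_real_derivative
      (- \<rho> * \<rho>' / q * r - q * \<rho>) / (r * r)) (at s)"
    using DERIV_divide[OF dq d(2)] * by (simp add: \<rho>_def r_def q_def)
  moreover have "(- \<rho> * \<rho>' / q * r - q * \<rho>) / (r * r) = \<rho> / r * fst (ew_field g \<beta> (q / r, r^2))"
  proof -
    have E: "fst (ew_field g \<beta> (q / r, r^2)) = q / r / 2 * (1 - 3 * (q / r) * \<rho>) - 3/2 * \<beta> * q^2 * g (r^2)"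
      using * by (simp add: ew_field_def Let_def power_divide s\<rho>)
    show ?thesis
      unfolding E \<rho>'_def using * q(1) by (simp add: field_simps power2_eq_square)
  qed
  moreover have "((\<lambda>s. (snd (y s))^2) has_real_derivative 2 * r * \<rho>) (at s)"
    using d(2) by (auto intro!: derivative_eq_intros simp: r_def)
  moreover have "2 * r * \<rho> = \<rho> / r * snd (ew_field g \<beta> (q / r, r^2))"
    using * by (simp add: ew_field_def Let_def power2_eq_square)
  ultimately show ?thesis
    unfolding has_vector_derivative_component_iff by (simp add: Phi_def q_def flip: \<rho>_def r_def)
qed

text \<open>The factor r/\<rho> is ds/dt. The derivative is taken within \<open>S\<close> because an
  orbit in \<open>Wu\<close> has only a one-sided derivative at t = 0.\<close>

lemma Psi_has_vector_derivative:
  assumes z: "z t \<in> N0" and der: "(z has_vector_derivative ew_field g \<beta> (z t)) (at t within S)"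
  shows "((\<lambda>t. Psi (z t)) has_vector_derivative (snd (Psi (z t)) / fst (Psi (z t))) *\<^sub>R toy_field g \<beta> (Psi (z t))) (at t within S)"
proof -
  define \<eta> w r \<rho> where "\<eta> = fst (z t)" and "w = snd (z t)" and "r = sqrt w" and "\<rho> = sqrt (1 - \<eta>^2 * w)"
  have *: "0 < \<eta>" "\<eta>^2 * w < 1" "0 < w" using z by (auto simp: N0_def N1_def \<eta>_def w_def)
  have r: "r > 0" "w = r^2" using * by (auto simp: r_def)
  have \<rho>: "\<rho> > 0" "\<rho>^2 = 1 - \<eta>^2 * w" using * by (auto simp: \<rho>_def)
  have sq: "sqrt (1 - \<rho>^2) = \<eta> * r"
    using * by (simp add: \<rho>(2) real_sqrt_mult r_def)
  define \<eta>' where "\<eta>' = \<eta> / 2 * (1 - 3 * \<eta> * \<rho>) - 3/2 * \<beta> * \<eta>^2 * w * g w"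
  have d: "((\<lambda>t. fst (z t)) has_real_derivative \<eta>') (at t within S)" "((\<lambda>t. snd (z t)) has_real_derivative 2 * w) (at t within S)"
    using der unfolding has_vector_derivative_component_iff
    by (auto simp: ew_field_def Let_def \<eta>'_def \<rho>_def simp flip: \<eta>_def w_def)
  have "((\<lambda>t. sqrt (1 - (fst (z t))^2 * snd (z t))) has_real_derivative
      - (2 * \<eta> * \<eta>' * w + \<eta>^2 * (2 * w)) / (2 * \<rho>)) (at t within S)"
    using d * by (auto intro!: derivative_eq_intros simp: \<eta>_def w_def \<rho>_def field_simps)
  moreover have "- (2 * \<eta> * \<eta>' * w + \<eta>^2 * (2 * w)) / (2 * \<rho>) = r / \<rho> * fst (toy_field g \<beta> (\<rho>, r))"
  proof -
    have F: "fst (toy_field g \<beta> (\<rho>, r)) = 3/2 * (\<eta>^2 * w) / r * (-1 + \<eta> * (\<beta> * w * g w + \<rho>))"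
      unfolding toy_field_def Let_def fst_conv snd_conv sq r(2)[symmetric] using r(1) by (simp add: \<rho>(2))
    show ?thesis
      unfolding F \<eta>'_def using r(1) \<rho>(1) by (simp add: field_simps power2_eq_square)
  qed
  moreover have "((\<lambda>t. sqrt (snd (z t))) has_real_derivative 2 * w / (2 * r)) (at t within S)"
    using d * by (auto intro!: derivative_eq_intros simp: w_def r_def field_simps)
  moreover have "2 * w / (2 * r) = r / \<rho> * snd (toy_field g \<beta> (\<rho>, r))"
    using r \<rho> by (simp add: toy_field_def Let_def power2_eq_square)
  ultimately show ?thesis
    unfolding has_vector_derivative_component_iff by (simp add: Psi_def \<rho>_def r_def flip: \<eta>_def w_def)
qed

text \<open>Serves to invert changes of time, both from s to ln r and back. That the image is again
  an open interval matters because solutions are glued only over such sets.\<close>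

lemma increasing_inverse:
  fixes f f' :: "real \<Rightarrow> real"
  assumes U: "open U" "is_interval U"
    and der: "\<And>x. x \<in> U \<Longrightarrow> (f has_real_derivative f' x) (at x)" "\<And>x. x \<in> U \<Longrightarrow> f' x > 0"
  obtains h where "\<And>x. x \<in> U \<Longrightarrow> h (f x) = x" "\<And>x. x \<in> U \<Longrightarrow> (h has_real_derivative inverse (f' x)) (at (f x))"
    "strict_mono_on U f" "open (f ` U)" "is_interval (f ` U)"
proof -
  have mono: "strict_mono_on U f"
  proof (rule strict_mono_onI)
    fix x y assume xy: "x \<in> U" "y \<in> U" "x < y"
    show "f x < f y"
      by (rule DERIV_pos_imp_increasing[OF xy(3)]) (use der mem_is_interval_1_I[OF U(2) xy(1,2)] in blast)
  qed
  then have inj: "inj_on f U" by (rule strict_mono_on_imp_inj_on)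
  have cont: "continuous_on U f"
    using der(1) DERIV_isCont continuous_at_imp_continuous_on by blast
  show ?thesis
  proof (rule that[of "the_inv_into U f"])
    fix x assume x: "x \<in> U"
    show "(the_inv_into U f has_real_derivative inverse (f' x)) (at (f x))"
      by (rule has_field_derivative_inverse_strong[OF der(1)[OF x] _ U(1) x cont])
        (use der(2)[OF x] inj the_inv_into_f_f in auto)
  next
    show "open (f ` U)" by (rule invariance_of_domain[OF cont U(1) inj])
    show "is_interval (f ` U)"
      using connected_continuous_image[OF cont] U(2) by (simp add: is_interval_connected_1)
  qed (use mono inj in \<open>auto simp: the_inv_into_f_f\<close>)
qed

section \<open>Orbits emanating from the equilibrium\<close>

text \<open>On the unit interval [t - 1, t] the mean value theorem equates an increment of
  \<open>f\<close> with a value of \<open>f'\<close>. Far to the left the increment is below |l|/4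
  in absolute value, while the value of \<open>f'\<close> exceeds |l|/2.\<close>

lemma deriv_tendsto_at_bot_zero:
  fixes f f' :: "real \<Rightarrow> real"
  assumes der: "\<And>t. t \<le> T \<Longrightarrow> (f has_real_derivative f' t) (at t)"
    and lim: "(f \<longlongrightarrow> L) at_bot" "(f' \<longlongrightarrow> l) at_bot"
  shows "l = 0"
proof (rule ccontr)
  assume l: "l \<noteq> 0"
  have "\<forall>\<^sub>F t in at_bot. dist (f t) L < \<bar>l\<bar> / 8" "\<forall>\<^sub>F t in at_bot. dist (f' t) l < \<bar>l\<bar> / 2"
    using tendstoD[OF lim(1), of "\<bar>l\<bar> / 8"] tendstoD[OF lim(2), of "\<bar>l\<bar> / 2"] l by auto
  then obtain N where N: "\<And>t. t \<le> N \<Longrightarrow> dist (f t) L < \<bar>l\<bar> / 8 \<and> dist (f' t) l < \<bar>l\<bar> / 2"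
    unfolding eventually_at_bot_linorder by (metis (mono_tags, lifting) linorder_linear order.trans)
  define t where "t = min N T"
  obtain \<xi> where \<xi>: "t - 1 < \<xi>" "\<xi> < t" "f t - f (t - 1) = (t - (t - 1)) * f' \<xi>"
  proof -
    have "\<exists>\<xi>>t - 1. \<xi> < t \<and> f t - f (t - 1) = (t - (t - 1)) * f' \<xi>"
      by (rule MVT2) (use der in \<open>auto simp: t_def\<close>)
    then show ?thesis using that by blast
  qed
  have "dist (f t) L < \<bar>l\<bar> / 8" "dist (f (t - 1)) L < \<bar>l\<bar> / 8" "dist (f' \<xi>) l < \<bar>l\<bar> / 2"
    using N \<xi> by (auto simp: t_def)
  then show False
    using \<xi>(3) unfolding dist_real_def by (simp only: diff_diff_eq2 add_diff_cancel_left' mult_1_left)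
qed

lemma isCont_ew_field:
  assumes "isCont g 0"
  shows "isCont (\<lambda>p. fst (ew_field g \<beta> p)) (\<eta>, 0)"
proof -
  have "isCont (\<lambda>p. g (snd p)) (\<eta>::real, 0)"
    by (rule isCont_o2[where g=g]) (use assms in auto)
  then show ?thesis
    unfolding ew_field_def Let_def fst_conv by (intro continuous_intros) simp_all
qed

text \<open>The w-component \<open>c * exp (2 * t)\<close> is common to both functions, so only the
  scalar \<eta>-equation has to be compared. Stated for functions of t, this covers the comparison
  with another orbit and with the analytic graph. Agreement at early times is enough, since later
  times are handled by uniqueness in the toy model.\<close>

lemma ew_unstable_unique:
  assumes g: "isCont g 0"
    and d1: "\<And>t. t < T \<Longrightarrow> (\<eta>1 has_real_derivative fst (ew_field g \<beta> (\<eta>1 t, c * exp (2 * t)))) (at t)"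
    and d2: "\<And>t. t < T \<Longrightarrow> (\<eta>2 has_real_derivative fst (ew_field g \<beta> (\<eta>2 t, c * exp (2 * t)))) (at t)"
    and lim: "(\<eta>1 \<longlongrightarrow> 1/3) at_bot" "(\<eta>2 \<longlongrightarrow> 1/3) at_bot"
  obtains T' where "T' \<le> T" "\<And>t. t < T' \<Longrightarrow> \<eta>1 t = \<eta>2 t"
proof -
  \<comment> \<open>The \<eta>-derivative of the field. By continuity it is negative on a whole
    neighbourhood of the equilibrium, where the field is therefore nonincreasing in \<eta>.\<close>
  define K where "K = (\<lambda>\<eta> w. 1/2 - 3 * \<eta> * sqrt (1 - \<eta>^2 * w) + 3/2 * \<eta>^3 * w / sqrt (1 - \<eta>^2 * w) - 3 * \<beta> * \<eta> * w * g w)"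
  have gp: "isCont (\<lambda>p. g (snd p)) (1/3::real, 0)"
    by (rule isCont_o2[where g=g]) (use g in auto)
  have "isCont (\<lambda>p. K (fst p) (snd p)) (1/3, 0)"
    unfolding K_def by (intro continuous_intros gp) auto
  then have "\<forall>\<^sub>F p in nhds (1/3, 0). K (fst p) (snd p) < 0"
    by (rule isCont_eventually_less) (simp add: K_def)
  moreover have "isCont (\<lambda>p. (fst p)^2 * snd p) (1/3::real, 0)"
    by (intro continuous_intros)
  then have "\<forall>\<^sub>F p in nhds (1/3::real, 0). (fst p)^2 * snd p < 1"
    by (rule isCont_eventually_less) simp
  ultimately have "\<forall>\<^sub>F p in nhds (1/3, 0). K (fst p) (snd p) < 0 \<and> (fst p)^2 * snd p < 1"
    by (rule eventually_conj)
  then obtain d where d: "d > 0"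
    and dK: "\<And>\<eta> w. dist (\<eta>, w) (1/3, 0) < d \<Longrightarrow> K \<eta> w < 0 \<and> \<eta>^2 * w < 1"
    unfolding eventually_nhds_metric by (metis fst_conv snd_conv)
  have near: "K \<eta> w < 0" "\<eta>^2 * w < 1" if "\<bar>\<eta> - 1/3\<bar> < d/2" "\<bar>w\<bar> < d/2" for \<eta> w
  proof -
    have "dist (\<eta>, w) (1/3, 0) = sqrt (\<bar>\<eta> - 1/3\<bar>^2 + \<bar>w\<bar>^2)"
      by (simp add: dist_norm norm_Pair)
    also have "\<dots> \<le> \<bar>\<eta> - 1/3\<bar> + \<bar>w\<bar>"
      by (rule sqrt_sum_squares_le_sum) auto
    also have "\<dots> < d" using that by simp
    finally show "K \<eta> w < 0" "\<eta>^2 * w < 1" using dK by auto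
  qed
  have dec: "fst (ew_field g \<beta> (b, w)) \<le> fst (ew_field g \<beta> (a, w))"
    if "a \<le> b" "\<bar>a - 1/3\<bar> < d/2" "\<bar>b - 1/3\<bar> < d/2" "\<bar>w\<bar> < d/2" for a b w
  proof (rule DERIV_nonpos_imp_nonincreasing[OF that(1)])
    fix x assume "a \<le> x" "x \<le> b"
    then have x: "\<bar>x - 1/3\<bar> < d/2" using that(2,3) by linarith
    define s where "s = sqrt (1 - x^2 * w)"
    have s: "s > 0" using near(2)[OF x that(4)] by (simp add: s_def)
    have S: "((\<lambda>x. sqrt (1 - x^2 * w)) has_real_derivative - x * w / s) (at x)"
      unfolding s_def using near(2)[OF x that(4)] by (auto intro!: derivative_eq_intros simp: field_simps)
    have "((\<lambda>x. x / 2 * (1 - 3 * x * sqrt (1 - x^2 * w)) - 3/2 * \<beta> * x^2 * w * g w) has_real_derivative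
        1/2 * (1 - 3 * x * s) + x / 2 * (- (3 * s + 3 * x * (- x * w / s))) - 3/2 * \<beta> * (2 * x) * w * g w) (at x)"
      by (rule derivative_eq_intros S refl | simp add: s_def[symmetric])+
    moreover have "1/2 * (1 - 3 * x * s) + x / 2 * (- (3 * s + 3 * x * (- x * w / s))) - 3/2 * \<beta> * (2 * x) * w * g w = K x w"
      unfolding K_def s_def[symmetric] using s by (simp add: field_simps power2_eq_square power3_eq_cube)
    ultimately show "\<exists>y. ((\<lambda>b. fst (ew_field g \<beta> (b, w))) has_real_derivative y) (at x) \<and> y \<le> 0"
      using near(1)[OF x that(4)] by (auto simp: ew_field_def Let_def intro!: exI[of _ "K x w"])
  qed
  have sign: "(a - b) * (fst (ew_field g \<beta> (a, w)) - fst (ew_field g \<beta> (b, w))) \<le> 0"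
    if "\<bar>a - 1/3\<bar> < d/2" "\<bar>b - 1/3\<bar> < d/2" "\<bar>w\<bar> < d/2" for a b w
    using dec[of a b w] dec[of b a w] that
    by (cases "a \<le> b") (auto intro: mult_nonpos_nonneg mult_nonneg_nonpos)
  have "((\<lambda>t::real. c * exp (2 * t)) \<longlongrightarrow> 0) at_bot"
    by real_asymp
  then have "\<forall>\<^sub>F t in at_bot. \<bar>c * exp (2 * t)\<bar> < d/2"
    using tendstoD[of _ 0 _ "d/2"] d by (fastforce simp: dist_real_def)
  moreover have "\<forall>\<^sub>F t in at_bot. \<bar>\<eta>1 t - 1/3\<bar> < d/2" "\<forall>\<^sub>F t in at_bot. \<bar>\<eta>2 t - 1/3\<bar> < d/2"
    using tendstoD[OF lim(1), of "d/2"] tendstoD[OF lim(2), of "d/2"] d by (auto simp: dist_real_def)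
  moreover have "\<forall>\<^sub>F t in at_bot. t < T"
    by (rule eventually_gt_at_bot)
  ultimately have "\<forall>\<^sub>F t in at_bot. \<bar>c * exp (2 * t)\<bar> < d/2 \<and> \<bar>\<eta>1 t - 1/3\<bar> < d/2 \<and> \<bar>\<eta>2 t - 1/3\<bar> < d/2 \<and> t < T"
    by (intro eventually_conj)
  then obtain T' where T': "\<And>t. t \<le> T' \<Longrightarrow> \<bar>c * exp (2 * t)\<bar> < d/2 \<and> \<bar>\<eta>1 t - 1/3\<bar> < d/2 \<and> \<bar>\<eta>2 t - 1/3\<bar> < d/2 \<and> t < T"
    unfolding eventually_at_bot_linorder by blast
  define D where "D = (\<lambda>t. (\<eta>1 t - \<eta>2 t)^2)"
  have mono: "D t \<le> D s" if "s \<le> t" "t \<le> T'" for s t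
  proof (rule DERIV_nonpos_imp_nonincreasing[OF that(1)])
    fix x assume "s \<le> x" "x \<le> t"
    then have x: "x \<le> T'" using that by auto
    define e where "e = (\<eta>1 x - \<eta>2 x) * (fst (ew_field g \<beta> (\<eta>1 x, c * exp (2 * x))) - fst (ew_field g \<beta> (\<eta>2 x, c * exp (2 * x))))"
    have "(D has_real_derivative 2 * e) (at x)"
      unfolding D_def e_def using d1[of x] d2[of x] T'[OF x]
      by (auto intro!: derivative_eq_intros)
    moreover have "e \<le> 0"
      unfolding e_def using T'[OF x] by (intro sign) auto
    ultimately show "\<exists>y. (D has_real_derivative y) (at x) \<and> y \<le> 0"
      by (intro exI[of _ "2 * e"]) auto
  qed
  have D0: "(D \<longlongrightarrow> 0) at_bot"
    unfolding D_def using lim by (auto intro!: tendsto_eq_intros)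
  have "\<eta>1 t = \<eta>2 t" if t: "t < T'" for t
  proof -
    have "\<forall>\<^sub>F s in at_bot. D t \<le> D s"
      using eventually_le_at_bot[of t] by eventually_elim (use mono t in auto)
    then have "D t \<le> 0"
      using tendsto_lowerbound[OF D0] by simp
    then show ?thesis by (simp add: D_def)
  qed
  moreover have "T' \<le> T" using T'[of T'] by simp
  ultimately show ?thesis using that by blast
qed

section \<open>Passage between orbits on the unstable manifold and toy solutions\<close>

text \<open>The backward orbit through \<open>Phi (y 0)\<close> becomes a toy solution
  \<open>X\<close> once time is changed by \<open>S\<close> with dS/dt = r/\<rho>. It agrees with
  \<open>y\<close> where both exist, and maximality of \<open>y\<close> makes its domain contain the
  whole backward orbit.\<close>

lemma Wloc_pullback:
  assumes g': "\<And>x. (g has_real_derivative g' x) (at x)" "continuous_on UNIV g'"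
    and max: "maximal_toy_solution g \<beta> y I" and 0: "0 \<in> I" "y 0 \<in> Wloc g \<beta>"
  obtains w0 z S where "w0 > 0"
    "\<And>t. t \<le> 0 \<Longrightarrow> z t \<in> N0" "\<And>t. t \<le> 0 \<Longrightarrow> snd (z t) = w0 * exp (2 * t)"
    "\<And>t. t < 0 \<Longrightarrow> ((\<lambda>t. fst (z t)) has_real_derivative fst (ew_field g \<beta> (z t))) (at t)"
    "(z \<longlongrightarrow> q0) at_bot"
    "S 0 = 0" "\<And>t. t \<le> 0 \<Longrightarrow> (S has_real_derivative snd (Psi (z t)) / fst (Psi (z t))) (at t)"
    "\<And>t. t \<le> 0 \<Longrightarrow> S t \<in> I" "\<And>t. t \<le> 0 \<Longrightarrow> y (S t) = Psi (z t)"
proof -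
  have y0: "y 0 \<in> M1" "Phi (y 0) \<in> N0" "Phi (y 0) \<in> Wu g \<beta>"
    using 0(2) by (auto simp: Wloc_def)
  then obtain z where z0: "z 0 = Phi (y 0)"
    and zN: "\<And>t. t \<le> 0 \<Longrightarrow> z t \<in> N1"
    and zd: "\<And>t. t \<le> 0 \<Longrightarrow> (z has_vector_derivative ew_field g \<beta> (z t)) (at t within {..0})"
    and zq: "(z \<longlongrightarrow> q0) at_bot"
    unfolding Wu_def by blast
  define w0 where "w0 = snd (z 0)"
  have w0: "w0 > 0" using y0(2) z0 by (auto simp: w0_def N0_def)
  have w: "snd (z t) = w0 * exp (2 * t)" if t: "t \<le> 0" for t
  proof -
    have "\<exists>c. \<forall>t\<in>{..0}. snd (z t) * exp (- 2 * t) = c"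
    proof (rule has_field_derivative_zero_constant)
      fix t :: real assume "t \<in> {..0}"
      then have "((\<lambda>t. snd (z t)) has_real_derivative 2 * snd (z t)) (at t within {..0})"
        using zd[of t] unfolding has_vector_derivative_component_iff by (simp add: ew_field_def Let_def)
      then show "((\<lambda>t. snd (z t) * exp (- 2 * t)) has_real_derivative 0) (at t within {..0})"
        by (auto intro!: derivative_eq_intros)
    qed simp
    then obtain c where c: "\<And>t. t \<le> 0 \<Longrightarrow> snd (z t) * exp (- 2 * t) = c" by auto
    have "snd (z t) * exp (- 2 * t) = w0"
      using c[of 0] c[OF t] by (simp add: w0_def)
    then show ?thesis
      by (simp add: exp_minus field_simps)
  qed
  have zN0: "z t \<in> N0" if "t \<le> 0" for t
    using zN[OF that] w[OF that] w0 by (auto simp: N0_def case_prod_unfold)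
  have PsiM1: "0 < fst (Psi (z t))" "0 < snd (Psi (z t))" if "t \<le> 0" for t
    using Psi_in_M1[OF zN0[OF that]] by (auto simp: M1_def)
  \<comment> \<open>Freezing the integrand for t > 0 makes it continuous and positive on the whole
    line, so \<open>S\<close> has a two-sided derivative at 0 and a global inverse.\<close>
  define k where "k = (\<lambda>t. snd (Psi (z (min t 0))) / fst (Psi (z (min t 0))))"
  have cz: "continuous_on {..0} z"
    by (rule continuous_on_vector_derivative[where f'="\<lambda>t. ew_field g \<beta> (z t)"]) (use zd in auto)
  have "continuous_on UNIV (\<lambda>t. z (min t 0))"
    by (rule continuous_on_compose2[OF cz]) (auto intro!: continuous_intros)
  then have "continuous_on UNIV k"
    unfolding k_def Psi_def fst_conv snd_conv
    using PsiM1(1)[of "min t 0" for t] by (intro continuous_intros) (simp_all add: Psi_def less_imp_neq)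
  then have kc: "isCont k t" for t
    by (simp add: continuous_on_eq_continuous_at)
  have kpos: "k t > 0" for t
    unfolding k_def using PsiM1[of "min t 0"] by simp
  obtain S0 where S0: "\<And>t. (S0 has_real_derivative k t) (at t)"
    using einterval_antiderivative[of "-\<infinity>" "\<infinity>" k] kc
    by (auto simp: has_real_derivative_iff_has_vector_derivative)
  define S where "S = (\<lambda>t. S0 t - S0 0)"
  have S: "(S has_real_derivative k t) (at t)" for t
    unfolding S_def using S0 by (auto intro!: derivative_eq_intros)
  have S_0: "S 0 = 0" by (simp add: S_def)
  have Sk: "(S has_real_derivative snd (Psi (z t)) / fst (Psi (z t))) (at t)" if "t \<le> 0" for t
    using S[of t] that by (simp add: k_def min_def)
  obtain h where h: "\<And>t. h (S t) = t" "\<And>t. (h has_real_derivative inverse (k t)) (at (S t))"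
    by (rule increasing_inverse[of UNIV S k]) (use S kpos in auto)
  \<comment> \<open>Two domains are used: the open one for gluing, and the one including 0 for
    uniqueness, because 0 is where \<open>X\<close> and \<open>y\<close> are known to
    coincide.\<close>
  obtain h' where K: "open (S ` {..<0})" "is_interval (S ` {..<0})"
    by (rule increasing_inverse[of "{..<0}" S k]) (use S kpos in \<open>auto simp: is_interval_1\<close>)
  have "continuous_on {..0} S"
    using S DERIV_isCont continuous_at_imp_continuous_on by blast
  then have K': "is_interval (S ` {..0})"
    using connected_continuous_image[of "{..0}" S] by (simp add: is_interval_connected_1)
  define X where "X = (\<lambda>s. Psi (z (h s)))"
  have X0: "X 0 = y 0"
    using h(1)[of 0] S_0 z0 Psi_Phi[OF y0(1)] by (simp add: X_def)
  have XS: "X (S t) = Psi (z t)" for t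
    by (simp add: X_def h)
  have XM: "X s \<in> M0" if "s \<in> S ` {..0}" for s
    using that subsetD[OF M1_subset_M0 Psi_in_M1[OF zN0]] by (auto simp: XS)
  have Xd: "(X has_vector_derivative toy_field g \<beta> (X s)) (at s within S ` {..0})" if s: "s \<in> S ` {..0}" for s
  proof -
    obtain t where t: "t \<le> 0" "s = S t" using s by auto
    have "h ` S ` {..0} = {..0}" by (simp add: image_image h)
    moreover have "((\<lambda>t. Psi (z t)) has_vector_derivative k t *\<^sub>R toy_field g \<beta> (Psi (z t))) (at t within {..0})"
      using Psi_has_vector_derivative[OF zN0[OF t(1)] zd[OF t(1)]] t by (simp add: k_def min_def)
    moreover have "(h has_vector_derivative inverse (k t)) (at s within S ` {..0})"
      using h(2)[of t] t has_field_derivative_at_within has_real_derivative_iff_has_vector_derivative by blast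
    ultimately have "((\<lambda>t. Psi (z t)) \<circ> h has_vector_derivative inverse (k t) *\<^sub>R k t *\<^sub>R toy_field g \<beta> (Psi (z t))) (at s within S ` {..0})"
      using h(1)[of t] t by (intro vector_diff_chain_within) simp_all
    then show ?thesis
      using kpos[of t] by (simp add: o_def X_def h t)
  qed
  have I: "open I" "is_interval I" "toy_solution g \<beta> y I"
    using max by (auto simp: maximal_toy_solution_def)
  have eq: "y s = X s" if "s \<in> I \<inter> S ` {..0}" for s
  proof (rule toy_solution_unique[OF g', where K="I \<inter> S ` {..0}" and ?s0.0=0 and \<beta>=\<beta>])
    show "is_interval (I \<inter> S ` {..0})"
      using I K' by (auto intro: is_interval_Int)
    show "(y has_vector_derivative toy_field g \<beta> (y s)) (at s within I \<inter> S ` {..0})" if "s \<in> I \<inter> S ` {..0}" for s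
      using that I by (auto simp: toy_solution_def intro: has_vector_derivative_at_within)
    show "(X has_vector_derivative toy_field g \<beta> (X s)) (at s within I \<inter> S ` {..0})" if "s \<in> I \<inter> S ` {..0}" for s
      using that by (intro has_vector_derivative_within_subset[OF Xd]) auto
    show "0 \<in> I \<inter> S ` {..0}" using 0 S_0 by (auto intro: image_eqI[of _ _ 0])
  qed (use that I XM X0 in \<open>auto simp: toy_solution_def\<close>)
  have "S ` {..<0} \<subseteq> I"
  proof (rule maximal_toy_solution_absorbs[OF max K])
    \<comment> \<open>\<open>I\<close> is a neighbourhood of \<open>S 0\<close>, so it contains
      \<open>S t\<close> for slightly negative t; this supplies the overlap needed for
      gluing.\<close>
    have "\<forall>\<^sub>F t in at 0. S t \<in> I"
      using topological_tendstoD[OF DERIV_isCont[OF S[of 0], unfolded isCont_def] I(1)] 0(1) S_0 by simp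
    then have "\<forall>\<^sub>F t in at_left 0. S t \<in> I"
      by (simp add: eventually_at_split)
    moreover have "\<forall>\<^sub>F t::real in at_left 0. t < 0"
      by (simp add: eventually_at_filter)
    ultimately have "\<forall>\<^sub>F t in at_left 0. S t \<in> I \<and> t < 0"
      by (rule eventually_conj)
    then obtain t where "S t \<in> I" "t < 0"
      using eventually_happens'[of "at_left (0::real)"] by auto
    then show "I \<inter> S ` {..<0} \<noteq> {}" by auto
    show "toy_solution g \<beta> X (S ` {..<0})"
      unfolding toy_solution_def
    proof
      fix s assume s: "s \<in> S ` {..<0}"
      then have s': "s \<in> S ` {..0}" by auto
      have "(X has_vector_derivative toy_field g \<beta> (X s)) (at s within S ` {..<0})"
        by (rule has_vector_derivative_within_subset[OF Xd[OF s']]) auto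
      then show "X s \<in> M0 \<and> (X has_vector_derivative toy_field g \<beta> (X s)) (at s)"
        using XM[OF s'] at_within_open[OF s K(1)] by simp
    qed
    show "X s = y s" if "s \<in> I \<inter> S ` {..<0}" for s
      using eq[of s] that by auto
  qed
  then have SI: "S t \<in> I" if "t \<le> 0" for t
    using that 0(1) S_0 by (cases "t = 0") auto
  show ?thesis
  proof (rule that[OF w0 zN0 w _ zq S_0 Sk SI])
    show "((\<lambda>t. fst (z t)) has_real_derivative fst (ew_field g \<beta> (z t))) (at t)" if "t < 0" for t
    proof -
      have "(z has_vector_derivative ew_field g \<beta> (z t)) (at t within {..<0})"
        by (rule has_vector_derivative_within_subset[OF zd]) (use that in auto)
      then show ?thesis
        using that at_within_open[of t "{..<0}"] unfolding has_vector_derivative_component_iff by simp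
    qed
    show "y (S t) = Psi (z t)" if "t \<le> 0" for t
      using eq[of "S t"] SI[OF that] that by (simp add: XS)
  qed
qed

text \<open>Close to the tip \<rho> > 0, so r is strictly increasing and ln r can serve as time; r
  tending to 0 means that this time reaches back to -\<infinity>.\<close>

lemma tip_meets_Wloc:
  assumes g: "isCont g 0" and b: "b > 0" and sol: "toy_solution g \<beta> y {0<..<b}"
    and lim1: "((\<lambda>s. fst (y s)) \<longlongrightarrow> 1) (at_right 0)"
    and lim0: "((\<lambda>s. snd (y s)) \<longlongrightarrow> 0) (at_right 0)"
    and lim\<eta>: "((\<lambda>s. sqrt (1 - (fst (y s))^2) / snd (y s)) \<longlongrightarrow> \<eta>0) (at_right 0)" "\<eta>0 > 0"
  obtains s where "s \<in> {0<..<b}" "y s \<in> Wloc g \<beta>"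
proof -
  have "\<forall>\<^sub>F s in at_right 0. fst (y s) > 0"
    using order_tendstoD(1)[OF lim1, of 0] by simp
  then obtain b0 where b0: "b0 > 0" "\<And>s. 0 < s \<Longrightarrow> s < b0 \<Longrightarrow> fst (y s) > 0"
    unfolding eventually_at_right_field by auto
  define b' where "b' = min b b0"
  define U where "U = {0<..<b'}"
  have b': "b' > 0" using b b0 by (simp add: b'_def)
  have yM0: "y s \<in> M0" and yd: "(y has_vector_derivative toy_field g \<beta> (y s)) (at s)" if "s \<in> U" for s
    using sol that by (auto simp: toy_solution_def U_def b'_def)
  have yM: "y s \<in> M1" if "s \<in> U" for s
    using yM0[OF that] b0(2)[of s] that by (auto simp: U_def b'_def M0_def M1_def case_prod_unfold)
  have pos: "fst (y s) > 0" "snd (y s) > 0" if "s \<in> U" for s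
    using yM[OF that] by (auto simp: M1_def)
  define f where "f = (\<lambda>s. ln (snd (y s)))"
  obtain h where h: "\<And>s. s \<in> U \<Longrightarrow> h (f s) = s"
    "\<And>s. s \<in> U \<Longrightarrow> (h has_real_derivative inverse (fst (y s) / snd (y s))) (at (f s))"
    and mono: "strict_mono_on U f" and fint: "is_interval (f ` U)"
  proof (rule increasing_inverse[of U f "\<lambda>s. fst (y s) / snd (y s)"])
    fix s assume s: "s \<in> U"
    have "((\<lambda>s. snd (y s)) has_real_derivative fst (y s)) (at s)"
      using yd[OF s] unfolding has_vector_derivative_component_iff by (simp add: snd_toy_field)
    then show "(f has_real_derivative fst (y s) / snd (y s)) (at s)"
      unfolding f_def using pos[OF s] by (auto intro!: derivative_eq_intros)
  qed (use pos in \<open>auto simp: U_def is_interval_1\<close>)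
  define s1 where "s1 = b' / 2"
  \<comment> \<open>Normalizes the new time so that t = 0 corresponds to \<open>s1\<close>.\<close>
  define l where "l = f s1"
  have s1: "s1 \<in> U" using b' by (simp add: s1_def U_def)
  have evU: "\<forall>\<^sub>F s in at_right 0. s \<in> U"
    unfolding U_def eventually_at_right_field using b' by auto
  \<comment> \<open>The image of \<open>f\<close> is an interval that is unbounded below because r
    tends to 0, and it contains l; hence it contains everything below l.\<close>
  have dom: "h (l + t) \<in> U \<and> f (h (l + t)) = l + t" if t: "t \<le> 0" for t
  proof -
    have "\<forall>\<^sub>F s in at_right 0. snd (y s) < exp (l + t)"
      by (rule order_tendstoD(2)[OF lim0]) simp
    with evU have "\<forall>\<^sub>F s in at_right 0. s \<in> U \<and> snd (y s) < exp (l + t)"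
      by (rule eventually_conj)
    then obtain s where s: "s \<in> U" "snd (y s) < exp (l + t)"
      using eventually_happens'[of "at_right (0::real)"] by auto
    then have "ln (snd (y s)) < ln (exp (l + t))"
      using pos[OF s(1)] by (subst ln_less_cancel_iff) auto
    then have "f s < l + t"
      by (simp add: f_def)
    then have "l + t \<in> f ` U"
      using mem_is_interval_1_I[OF fint, of "f s" "f s1" "l + t"] s s1 t by (auto simp: l_def)
    then show ?thesis using h(1) by auto
  qed
  define z where "z = (\<lambda>t. Phi (y (h (l + t))))"
  have z0: "z 0 = Phi (y s1)"
    using h(1)[OF s1] by (simp add: z_def l_def)
  have zd: "(z has_vector_derivative ew_field g \<beta> (z t)) (at t)" if t: "t \<le> 0" for t
  proof -
    define s where "s = h (l + t)"
    have s: "s \<in> U" "f s = l + t" using dom[OF t] by (auto simp: s_def)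
    have "((\<lambda>t. h (l + t)) has_real_derivative inverse (fst (y s) / snd (y s)) * 1) (at t)"
      by (rule DERIV_chain2[where f=h]) (use h(2)[OF s(1)] s(2) in \<open>auto intro!: derivative_eq_intros\<close>)
    then have "((\<lambda>t. h (l + t)) has_vector_derivative inverse (fst (y s) / snd (y s))) (at t)"
      by (simp add: has_real_derivative_iff_has_vector_derivative)
    then have "((\<lambda>s. Phi (y s)) \<circ> (\<lambda>t. h (l + t)) has_vector_derivative
        inverse (fst (y s) / snd (y s)) *\<^sub>R (fst (y s) / snd (y s)) *\<^sub>R ew_field g \<beta> (Phi (y s))) (at t)"
      using Phi_has_vector_derivative[OF yM[OF s(1)] yd[OF s(1)]] unfolding s_def
      by (rule vector_diff_chain_at)
    then show ?thesis
      using pos[OF s(1)] by (simp add: o_def z_def s_def)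
  qed
  have hlim: "filterlim (\<lambda>t. h (l + t)) (at_right 0) at_bot"
    unfolding filterlim_at
  proof
    show "\<forall>\<^sub>F t in at_bot. h (l + t) \<in> {0<..} \<and> h (l + t) \<noteq> 0"
      using eventually_le_at_bot[of 0] by eventually_elim (use dom in \<open>force simp: U_def\<close>)
    show "((\<lambda>t. h (l + t)) \<longlongrightarrow> 0) at_bot"
    proof (rule tendstoI)
      fix e :: real assume e: "e > 0"
      define e' where "e' = min e b' / 2"
      have e': "e' \<in> U" "e' < e" using e b' by (auto simp: e'_def U_def)
      have "\<forall>\<^sub>F t in at_bot. t \<le> 0 \<and> t < f e' - l"
        by (intro eventually_conj eventually_le_at_bot eventually_gt_at_bot)
      then show "\<forall>\<^sub>F t in at_bot. dist (h (l + t)) 0 < e"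
      proof eventually_elim
        case (elim t)
        have t: "h (l + t) \<in> U" "f (h (l + t)) < f e'" using dom[of t] elim by auto
        have "h (l + t) < e'"
          using strict_mono_on_less[OF mono t(1) e'(1)] t(2) by simp
        then show ?case using t(1) e' by (simp add: U_def)
      qed
    qed
  qed
  have z\<eta>: "((\<lambda>t. fst (z t)) \<longlongrightarrow> \<eta>0) at_bot"
    using filterlim_compose[OF lim\<eta>(1) hlim] by (simp add: z_def Phi_def)
  have "((\<lambda>s. (snd (y s))^2) \<longlongrightarrow> 0) (at_right 0)"
    using tendsto_power[OF lim0, of 2] by simp
  from filterlim_compose[OF this hlim] have zw: "((\<lambda>t. snd (z t)) \<longlongrightarrow> 0) at_bot"
    by (simp add: z_def Phi_def)
  have zlim: "(z \<longlongrightarrow> (\<eta>0, 0)) at_bot"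
    using tendsto_Pair[OF z\<eta> zw] by simp
  have "((\<lambda>t. fst (ew_field g \<beta> (z t))) \<longlongrightarrow> fst (ew_field g \<beta> (\<eta>0, 0))) at_bot"
    by (rule isCont_tendsto_compose[OF isCont_ew_field[OF g] zlim])
  then have "fst (ew_field g \<beta> (\<eta>0, 0)) = 0"
    by (intro deriv_tendsto_at_bot_zero[where f="\<lambda>t. fst (z t)" and T=0 and L=\<eta>0 and f'="\<lambda>t. fst (ew_field g \<beta> (z t))"])
      (use zd z\<eta> in \<open>auto simp: has_vector_derivative_component_iff\<close>)
  \<comment> \<open>The equilibrium condition is \<eta>0 (1 - 3 \<eta>0) = 0, and \<eta>0 > 0 leaves
    only one root.\<close>
  then have "\<eta>0 = 1/3"
    using lim\<eta>(2) by (simp add: ew_field_def Let_def)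
  have "Phi (y s1) \<in> Wu g \<beta>"
    unfolding Wu_def
  proof (intro CollectI exI[of _ z] conjI allI impI)
    fix t :: real assume t: "t \<le> 0"
    show "z t \<in> N1"
      unfolding z_def using dom[OF t] yM Phi_in_N0 N0_subset_N1 by blast
    show "(z has_vector_derivative ew_field g \<beta> (z t)) (at t within {..0})"
      by (rule has_vector_derivative_at_within[OF zd[OF t]])
  qed (use z0 zlim \<open>\<eta>0 = 1/3\<close> in \<open>auto simp: q0_def\<close>)
  then have "y s1 \<in> Wloc g \<beta>"
    using yM[OF s1] Phi_in_N0 by (auto simp: Wloc_def)
  then show ?thesis
    using that[of s1] s1 by (auto simp: U_def b'_def)
qed

section \<open>Tip solutions\<close>

lemma Wloc_same_orbit:
  assumes g': "\<And>x. (g has_real_derivative g' x) (at x)" "continuous_on UNIV g'"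
    and y: "maximal_toy_solution g \<beta> y I" "s1 \<in> I" "y s1 \<in> Wloc g \<beta>"
    and x: "maximal_toy_solution g \<beta> x J" "s2 \<in> J" "x s2 \<in> Wloc g \<beta>"
  shows "y ` I = x ` J"
proof -
  define y' I' where "y' = (\<lambda>s. y (s + s1))" and "I' = (\<lambda>s. s - s1) ` I"
  define x' J' where "x' = (\<lambda>s. x (s + s2))" and "J' = (\<lambda>s. s - s2) ` J"
  have y': "maximal_toy_solution g \<beta> y' I'" "0 \<in> I'" "y' 0 \<in> Wloc g \<beta>"
    using maximal_toy_solution_shift[OF y(1)] y by (auto simp: y'_def I'_def)
  have x': "maximal_toy_solution g \<beta> x' J'" "0 \<in> J'" "x' 0 \<in> Wloc g \<beta>"
    using maximal_toy_solution_shift[OF x(1)] x by (auto simp: x'_def J'_def)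
  obtain w1 z1 S1 where z1: "w1 > 0"
    "\<And>t. t \<le> 0 \<Longrightarrow> z1 t \<in> N0" "\<And>t. t \<le> 0 \<Longrightarrow> snd (z1 t) = w1 * exp (2 * t)"
    "\<And>t. t < 0 \<Longrightarrow> ((\<lambda>t. fst (z1 t)) has_real_derivative fst (ew_field g \<beta> (z1 t))) (at t)"
    "(z1 \<longlongrightarrow> q0) at_bot" "S1 0 = 0"
    "\<And>t. t \<le> 0 \<Longrightarrow> (S1 has_real_derivative snd (Psi (z1 t)) / fst (Psi (z1 t))) (at t)"
    "\<And>t. t \<le> 0 \<Longrightarrow> S1 t \<in> I'" "\<And>t. t \<le> 0 \<Longrightarrow> y' (S1 t) = Psi (z1 t)"
    by (fact Wloc_pullback[OF g' y'])
  obtain w2 z2 S2 where z2: "w2 > 0"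
    "\<And>t. t \<le> 0 \<Longrightarrow> z2 t \<in> N0" "\<And>t. t \<le> 0 \<Longrightarrow> snd (z2 t) = w2 * exp (2 * t)"
    "\<And>t. t < 0 \<Longrightarrow> ((\<lambda>t. fst (z2 t)) has_real_derivative fst (ew_field g \<beta> (z2 t))) (at t)"
    "(z2 \<longlongrightarrow> q0) at_bot" "S2 0 = 0"
    "\<And>t. t \<le> 0 \<Longrightarrow> (S2 has_real_derivative snd (Psi (z2 t)) / fst (Psi (z2 t))) (at t)"
    "\<And>t. t \<le> 0 \<Longrightarrow> S2 t \<in> J'" "\<And>t. t \<le> 0 \<Longrightarrow> x' (S2 t) = Psi (z2 t)"
    by (fact Wloc_pullback[OF g' x'])
  \<comment> \<open>The two orbits may start at different heights w; this time shift matches their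
    w-components.\<close>
  define \<tau> where "\<tau> = ln (w1 / w2) / 2"
  have \<tau>: "w2 * exp (2 * (t + \<tau>)) = w1 * exp (2 * t)" for t
    using z1(1) z2(1) by (simp add: \<tau>_def distrib_left exp_add)
  have pair1: "z1 t = (fst (z1 t), w1 * exp (2 * t))" if "t \<le> 0" for t
    using z1(3)[OF that] by (simp add: prod_eq_iff)
  have pair2: "z2 (t + \<tau>) = (fst (z2 (t + \<tau>)), w1 * exp (2 * t))" if "t + \<tau> \<le> 0" for t
    using z2(3)[OF that] \<tau>[of t] by (simp add: prod_eq_iff)
  have lim1: "((\<lambda>t. fst (z1 t)) \<longlongrightarrow> 1/3) at_bot" and lim2: "((\<lambda>t. fst (z2 t)) \<longlongrightarrow> 1/3) at_bot"
    using tendsto_fst[OF z1(5)] tendsto_fst[OF z2(5)] by (simp_all add: q0_def)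
  have "filterlim (\<lambda>t. t + \<tau>) at_bot at_bot"
    by real_asymp
  then have lim2': "((\<lambda>t. fst (z2 (t + \<tau>))) \<longlongrightarrow> 1/3) at_bot"
    by (rule filterlim_compose[OF lim2])
  obtain T' where T': "T' \<le> min 0 (- \<tau>)" "\<And>t. t < T' \<Longrightarrow> fst (z1 t) = fst (z2 (t + \<tau>))"
  proof (rule ew_unstable_unique[of g "min 0 (- \<tau>)" "\<lambda>t. fst (z1 t)" \<beta> w1 "\<lambda>t. fst (z2 (t + \<tau>))"])
    show "isCont g 0" using g'(1) DERIV_isCont by blast
    fix t assume t: "t < min 0 (- \<tau>)"
    show "((\<lambda>t. fst (z1 t)) has_real_derivative fst (ew_field g \<beta> (fst (z1 t), w1 * exp (2 * t)))) (at t)"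
      using z1(4)[of t] pair1[of t] t by simp
    have "((\<lambda>t. fst (z2 (t + \<tau>))) has_real_derivative fst (ew_field g \<beta> (z2 (t + \<tau>))) * 1) (at t)"
      by (rule DERIV_chain2[where f="\<lambda>t. fst (z2 t)"]) (use z2(4)[of "t + \<tau>"] t in \<open>auto intro!: derivative_eq_intros\<close>)
    then show "((\<lambda>t. fst (z2 (t + \<tau>))) has_real_derivative fst (ew_field g \<beta> (fst (z2 (t + \<tau>)), w1 * exp (2 * t)))) (at t)"
      using pair2[of t] t by simp
  qed (use lim1 lim2' in auto)
  \<comment> \<open>One common point at a single early time suffices; determinism of the toy model
    propagates the agreement to the whole orbits.\<close>
  define t where "t = T' - 1"
  have t: "t \<le> 0" "t + \<tau> \<le> 0" "t < T'" using T'(1) by (auto simp: t_def)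
  have "z1 t = z2 (t + \<tau>)"
    using pair1[OF t(1)] pair2[OF t(2)] T'(2)[OF t(3)] by metis
  then have "y' (S1 t) = x' (S2 (t + \<tau>))"
    using z1(9) z2(9) t by simp
  then have "y' ` I' = x' ` J'"
    by (rule maximal_toy_solution_same_orbit[OF g' y'(1) x'(1) z1(8)[OF t(1)] z2(8)[OF t(2)]])
  then show ?thesis
    by (simp add: y'_def x'_def I'_def J'_def image_image)
qed

text \<open>The right end is taken as a supremum in the extended reals, so unbounded intervals need
  no separate case. It is not attained because \<open>I\<close> is open.\<close>

lemma open_interval_ereal_bound:
  fixes I :: "real set"
  assumes "open I" "is_interval I" "s1 \<in> I" and lower: "\<And>s. s \<in> I \<Longrightarrow> c < s" "\<And>s. c < s \<Longrightarrow> s \<le> s1 \<Longrightarrow> s \<in> I"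
  shows "\<exists>smax::ereal. 0 < smax \<and> (\<lambda>s. s - c) ` I = {s. 0 < s \<and> ereal s < smax}"
proof -
  define m where "m = (SUP s\<in>I. ereal (s - c))"
  have up: "ereal (s - c) < m" if s: "s \<in> I" for s
  proof -
    obtain e where "e > 0" "ball s e \<subseteq> I"
      using assms(1) s openE by blast
    then have "s + e / 2 \<in> I" "s < s + e / 2" by (auto simp: subset_iff dist_real_def)
    then have "ereal (s - c) < ereal (s + e / 2 - c)" "ereal (s + e / 2 - c) \<le> m"
      unfolding m_def by (auto intro: SUP_upper)
    then show ?thesis by (rule less_le_trans)
  qed
  have "0 < ereal (s1 - c)" using lower(1)[OF assms(3)] by simp
  then have "0 < m" using up[OF assms(3)] by (rule less_trans)
  moreover have "(\<lambda>s. s - c) ` I = {s. 0 < s \<and> ereal s < m}"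
  proof (intro equalityI subsetI)
    fix s assume "s \<in> (\<lambda>s. s - c) ` I"
    then show "s \<in> {s. 0 < s \<and> ereal s < m}" using up lower(1) by auto
  next
    fix s assume "s \<in> {s. 0 < s \<and> ereal s < m}"
    then obtain s' where s': "0 < s" "s' \<in> I" "s < s' - c"
      unfolding m_def by (auto simp: less_SUP_iff)
    have "s + c \<in> I"
    proof (cases "s + c \<le> s1")
      case True
      then show ?thesis using s'(1) by (intro lower(2)) auto
    next
      case False
      then show ?thesis
        using s' by (intro mem_is_interval_1_I[OF assms(2,3) s'(2)]) auto
    qed
    then show "s \<in> (\<lambda>s. s - c) ` I" by (intro image_eqI[of _ _ "s + c"]) auto
  qed
  ultimately show ?thesis by blast
qed

section \<open>Construction of a tip solution from the unstable manifold\<close>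

text \<open>The translation constant is the infimum c of the times \<open>S t\<close>. It is finite,
  is not in \<open>I\<close> because r tends to 0 there, and is therefore the left end of the
  maximal interval. The limits are read off from the orbit, and G from the analytic graph that the
  orbit follows at early times.\<close>

lemma Wloc_imp_tip:
  assumes g: "real_analytic_on g UNIV"
    and g': "\<And>x. (g has_real_derivative g' x) (at x)" "continuous_on UNIV g'"
    and max: "maximal_toy_solution g \<beta> y I" and 0: "0 \<in> I" "y 0 \<in> Wloc g \<beta>"
  shows "\<exists>c. toy_tip_solution g \<beta> (\<lambda>s. y (s + c)) ((\<lambda>s. s - c) ` I)"
proof -
  have contg: "isCont g x" for x using g'(1) DERIV_isCont by blast
  have I: "open I" "is_interval I" "toy_solution g \<beta> y I"
    using max by (auto simp: maximal_toy_solution_def)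
  obtain w0 z S where w0: "w0 > 0"
    and zN: "\<And>t. t \<le> 0 \<Longrightarrow> z t \<in> N0" and zw: "\<And>t. t \<le> 0 \<Longrightarrow> snd (z t) = w0 * exp (2 * t)"
    and zd: "\<And>t. t < 0 \<Longrightarrow> ((\<lambda>t. fst (z t)) has_real_derivative fst (ew_field g \<beta> (z t))) (at t)"
    and zq: "(z \<longlongrightarrow> q0) at_bot"
    and S0: "S 0 = 0" and Sd: "\<And>t. t \<le> 0 \<Longrightarrow> (S has_real_derivative snd (Psi (z t)) / fst (Psi (z t))) (at t)"
    and SI: "\<And>t. t \<le> 0 \<Longrightarrow> S t \<in> I" and yS: "\<And>t. t \<le> 0 \<Longrightarrow> y (S t) = Psi (z t)"
    by (fact Wloc_pullback[OF g' max 0])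
  have lim\<eta>: "((\<lambda>t. fst (z t)) \<longlongrightarrow> 1/3) at_bot" and limw: "((\<lambda>t. snd (z t)) \<longlongrightarrow> 0) at_bot"
    using tendsto_fst[OF zq] tendsto_snd[OF zq] by (simp_all add: q0_def)
  have lim\<rho>: "((\<lambda>t. fst (Psi (z t))) \<longlongrightarrow> 1) at_bot"
    unfolding Psi_def fst_conv by (rule tendsto_eq_intros lim\<eta> limw refl | simp)+
  have limr: "((\<lambda>t. snd (Psi (z t))) \<longlongrightarrow> 0) at_bot"
    unfolding Psi_def snd_conv by (rule tendsto_eq_intros limw refl | simp)+
  have Mpos: "0 < fst (Psi (z t))" "fst (Psi (z t)) < 1" "0 < snd (Psi (z t))" if "t \<le> 0" for t
    using Psi_in_M1[OF zN[OF that]] by (auto simp: M1_def)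
  have Smono: "S s < S t" if "s < t" "t \<le> 0" for s t
  proof (rule DERIV_pos_imp_increasing[OF that(1)])
    fix x assume "s \<le> x" "x \<le> t"
    then have "x \<le> 0" using that by simp
    then show "\<exists>d. (S has_real_derivative d) (at x) \<and> d > 0"
      using Sd[of x] Mpos[of x] by (intro exI[of _ "snd (Psi (z x)) / fst (Psi (z x))"]) simp
  qed
  have Scont: "isCont S t" if "t \<le> 0" for t
    using DERIV_isCont[OF Sd[OF that]] .
  \<comment> \<open>Once \<rho> > 1/2, the derivative of \<open>S\<close>, r/\<rho>, is at most 2r,
    and r = \<open>r0 * exp t\<close> is integrable at -\<infinity>; subtracting the primitive
    \<open>2 * r0 * exp t\<close> turns this into monotonicity.\<close>
  obtain m where m: "\<And>t. t \<le> 0 \<Longrightarrow> m \<le> S t"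
  proof -
    have "\<forall>\<^sub>F t in at_bot. fst (Psi (z t)) > 1/2"
      by (rule order_tendstoD(1)[OF lim\<rho>]) simp
    then obtain T0 where T0: "\<And>t. t \<le> T0 \<Longrightarrow> fst (Psi (z t)) > 1/2"
      unfolding eventually_at_bot_linorder by blast
    define T where "T = min T0 0"
    define r0 where "r0 = sqrt w0"
    have r: "snd (Psi (z t)) = r0 * exp t" if "t \<le> 0" for t
    proof -
      have "exp (2 * t) = (exp t)^2" by (simp add: exp_double)
      then show ?thesis using zw[OF that] by (simp add: Psi_def real_sqrt_mult r0_def)
    qed
    have "S T - 2 * r0 * exp T \<le> S t" if t: "t \<le> T" for t
    proof -
      have "S T - 2 * r0 * exp T \<le> S t - 2 * r0 * exp t"
      proof (rule DERIV_nonpos_imp_nonincreasing[OF t])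
        fix x assume "t \<le> x" "x \<le> T"
        then have x: "x \<le> 0" "x \<le> T0" by (auto simp: T_def)
        have "((\<lambda>x. S x - 2 * r0 * exp x) has_real_derivative snd (Psi (z x)) / fst (Psi (z x)) - 2 * r0 * exp x) (at x)"
          using Sd[OF x(1)] by (auto intro!: derivative_eq_intros)
        moreover have "snd (Psi (z x)) / fst (Psi (z x)) \<le> snd (Psi (z x)) / (1/2)"
          using T0[OF x(2)] Mpos[OF x(1)] by (intro divide_left_mono) auto
        ultimately show "\<exists>d. ((\<lambda>x. S x - 2 * r0 * exp x) has_real_derivative d) (at x) \<and> d \<le> 0"
          using r[OF x(1)] by (intro exI conjI) auto
      qed
      also have "\<dots> \<le> S t" using w0 by (simp add: r0_def)
      finally show ?thesis .
    qed
    moreover have "S T \<le> S t" if "T \<le> t" "t \<le> 0" for t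
      using Smono[of T t] that by (cases "T = t") auto
    moreover have "S T - 2 * r0 * exp T \<le> S T" using w0 by (simp add: r0_def)
    ultimately have "S T - 2 * r0 * exp T \<le> S t" if "t \<le> 0" for t
      using that by (meson linorder_linear order_trans)
    then show ?thesis using that by blast
  qed
  define c where "c = (INF t\<in>{..0}. S t)"
  have bdd: "bdd_below (S ` {..0})" using m by (auto intro!: bdd_belowI)
  have cS: "c < S t" if "t \<le> 0" for t
  proof -
    have "c \<le> S (t - 1)" unfolding c_def using that by (intro cINF_lower bdd) auto
    also have "\<dots> < S t" by (rule Smono) (use that in auto)
    finally show ?thesis .
  qed
  have surj: "\<exists>t\<le>T. S t = s" if s: "c < s" "s \<le> S T" "T \<le> 0" for s T
  proof -
    obtain t0 where t0: "t0 \<le> 0" "S t0 < s"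
      using s(1) cINF_less_iff[OF _ bdd] by (auto simp: c_def)
    have "t0 \<le> T" using Smono[of T t0] t0 that by force
    then have "\<exists>t. t0 \<le> t \<and> t \<le> T \<and> S t = s"
      by (intro IVT) (use t0 that Scont in auto)
    then show ?thesis by blast
  qed
  \<comment> \<open>The inverse time change, meaningful for c < s and s at most 0 only, where
    \<open>surj\<close> provides a witness.\<close>
  define \<tau> where "\<tau> = (\<lambda>s. SOME t. t \<le> 0 \<and> S t = s)"
  have \<tau>: "\<tau> s \<le> 0" "S (\<tau> s) = s" if "c < s" "s \<le> 0" for s
    using surj[of s 0] that S0 someI_ex[of "\<lambda>t. t \<le> 0 \<and> S t = s"] by (auto simp: \<tau>_def)
  have y\<tau>: "y s = Psi (z (\<tau> s))" if "c < s" "s \<le> 0" for s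
    using yS[OF \<tau>(1)[OF that]] \<tau>(2)[OF that] by simp
  have c0: "c < 0" using cS[of 0] S0 by simp
  have evc: "\<forall>\<^sub>F s in at_right 0. 0 < s \<and> s + c < 0"
    unfolding eventually_at_right_field using c0 by (intro exI[of _ "- c"]) auto
  have \<tau>lim: "filterlim (\<lambda>s. \<tau> (s + c)) at_bot (at_right 0)"
    unfolding filterlim_at_bot_le[where c=0]
  proof (intro allI impI)
    fix B :: real assume B: "B \<le> 0"
    have "\<forall>\<^sub>F s in at_right 0. 0 < s \<and> s < S B - c"
      unfolding eventually_at_right_field using cS[OF B] by (intro exI[of _ "S B - c"]) auto
    with evc show "\<forall>\<^sub>F s in at_right 0. \<tau> (s + c) \<le> B"
    proof eventually_elim
      case (elim s)
      then have "\<tau> (s + c) \<le> 0" "S (\<tau> (s + c)) = s + c" using \<tau>[of "s + c"] by auto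
      then show ?case using Smono[of B "\<tau> (s + c)"] elim by force
    qed
  qed
  have Yeq: "\<forall>\<^sub>F s in at_right 0. y (s + c) = Psi (z (\<tau> (s + c)))"
    using evc by eventually_elim (use y\<tau> in auto)
  \<comment> \<open>A solution defined at c would be continuous there, forcing r = 0 against
    \<open>M0\<close>.\<close>
  have cI: "c \<notin> I"
  proof
    assume "c \<in> I"
    then have yc: "y c \<in> M0" "isCont y c"
      using I(3) has_vector_derivative_continuous[of y "toy_field g \<beta> (y c)" c UNIV]
      by (auto simp: toy_solution_def)
    have "((\<lambda>s. snd (y s)) \<longlongrightarrow> snd (y c)) (at_right c)"
      using yc(2) unfolding isCont_def by (intro tendsto_snd) (auto intro: filterlim_mono at_le)
    then have "((\<lambda>s. snd (y (s + c))) \<longlongrightarrow> snd (y c)) (at_right 0)"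
      by (subst (asm) at_right_to_0) (simp add: filterlim_filtermap)
    moreover have "((\<lambda>s. snd (y (s + c))) \<longlongrightarrow> 0) (at_right 0)"
      using filterlim_compose[OF limr \<tau>lim]
      by (rule Lim_transform_eventually) (use Yeq in eventually_elim, simp)
    ultimately have "snd (y c) = 0"
      using tendsto_unique[OF trivial_limit_at_right_real] by blast
    with yc(1) show False by (auto simp: M0_def)
  qed
  have low1: "c < s" if "s \<in> I" for s
  proof (rule ccontr)
    assume "\<not> c < s"
    then have "c \<in> I" using mem_is_interval_1_I[OF I(2) that 0(1), of c] c0 by auto
    with cI show False by simp
  qed
  have low2: "s \<in> I" if "c < s" "s \<le> 0" for s
    using SI[OF \<tau>(1)[OF that]] \<tau>(2)[OF that] by simp
  define Y where "Y = (\<lambda>s. y (s + c))"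
  define D where "D = (\<lambda>s. s - c) ` I"
  have Ysol: "toy_solution g \<beta> Y D"
    unfolding Y_def D_def by (rule toy_solution_shift[OF I(3)])
  have inD: "s \<in> D" if "0 < s" "s + c \<le> 0" for s
    using low2[of "s + c"] that unfolding D_def by (intro image_eqI[of _ _ "s + c"]) auto
  have L1: "((\<lambda>s. fst (Y s)) \<longlongrightarrow> 1) (at_right 0)"
    using filterlim_compose[OF lim\<rho> \<tau>lim] unfolding Y_def
    by (rule Lim_transform_eventually) (use Yeq in eventually_elim, simp)
  have L2: "((\<lambda>s. snd (Y s)) \<longlongrightarrow> 0) (at_right 0)"
    using filterlim_compose[OF limr \<tau>lim] unfolding Y_def
    by (rule Lim_transform_eventually) (use Yeq in eventually_elim, simp)
  have L3: "((\<lambda>s. sqrt (1 - (fst (Y s))^2) / snd (Y s)) \<longlongrightarrow> 1/3) (at_right 0)"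
    using filterlim_compose[OF lim\<eta> \<tau>lim]
  proof (rule Lim_transform_eventually)
    show "\<forall>\<^sub>F s in at_right 0. fst (z (\<tau> (s + c))) = sqrt (1 - (fst (Y s))^2) / snd (Y s)"
      using evc Yeq
    proof eventually_elim
      case (elim s)
      then have "Phi (Y s) = z (\<tau> (s + c))"
        using \<tau>(1)[of "s + c"] Phi_Psi[OF zN] by (simp add: Y_def)
      then show ?case unfolding Phi_def by (metis fst_conv)
    qed
  qed
  \<comment> \<open>The sign of \<rho>' is that of the bracket in the field, which tends to -1 + 1/3
    < 0 at the tip.\<close>
  have neg: "\<forall>\<^sub>F s in at_right 0. s \<in> D \<and> deriv (\<lambda>t. fst (Y t)) s < 0 \<and> fst (Y s) > 0"
  proof -
    have "((\<lambda>s. g ((snd (Y s))^2)) \<longlongrightarrow> g (0^2)) (at_right 0)"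
      by (rule isCont_tendsto_compose[OF contg]) (intro tendsto_intros L2)
    then have "((\<lambda>s. -1 + sqrt (1 - (fst (Y s))^2) / snd (Y s) * (\<beta> * (snd (Y s))^2 * g ((snd (Y s))^2) + fst (Y s)))
        \<longlongrightarrow> -1 + 1/3 * (\<beta> * 0^2 * g (0^2) + 1)) (at_right 0)"
      by (intro tendsto_intros L1 L2 L3)
    then have "\<forall>\<^sub>F s in at_right 0. -1 + sqrt (1 - (fst (Y s))^2) / snd (Y s) * (\<beta> * (snd (Y s))^2 * g ((snd (Y s))^2) + fst (Y s)) < 0"
      by (rule order_tendstoD(2)) simp
    moreover have "\<forall>\<^sub>F s in at_right 0. fst (Y s) > 0"
      by (rule order_tendstoD(1)[OF L1]) simp
    ultimately show ?thesis
      using evc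
    proof eventually_elim
      case (elim s)
      have sD: "s \<in> D" using elim by (intro inD) auto
      then have "Y s \<in> M0" "(Y has_vector_derivative toy_field g \<beta> (Y s)) (at s)"
        using Ysol by (auto simp: toy_solution_def)
      then have Y: "- 1 < fst (Y s)" "fst (Y s) < 1" "0 < snd (Y s)"
        and "((\<lambda>t. fst (Y t)) has_real_derivative fst (toy_field g \<beta> (Y s))) (at s)"
        by (auto simp: M0_def has_vector_derivative_component_iff)
      then have "deriv (\<lambda>t. fst (Y t)) s = fst (toy_field g \<beta> (Y s))"
        by (intro DERIV_imp_deriv)
      moreover have "(fst (Y s))^2 < 1" using Y by (simp add: abs_square_less_1 abs_less_iff)
      then have "fst (toy_field g \<beta> (Y s)) < 0"
        unfolding toy_field_def Let_def fst_conv using elim(1) Y(3) by (intro mult_pos_neg) simp_all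
      ultimately show ?case using sD elim by simp
    qed
  qed
  obtain R h H where R: "R > 0" and h: "h holomorphic_on ball 0 R"
    and hH: "\<And>x. \<bar>x\<bar> < R \<Longrightarrow> h (of_real x) = of_real (H x)"
    and hsmall: "\<And>w. w \<in> ball 0 R \<Longrightarrow> norm (h w ^ 2 * w) < 1/2"
    and H0: "H 0 = 1/3"
    and HD: "\<And>x. \<bar>x\<bar> < R \<Longrightarrow> \<exists>D. (H has_real_derivative D) (at x) \<and> 2 * x * D = fst (ew_field g \<beta> (H x, x))"
    by (fact ew_field_holomorphic_graph[OF g, of \<beta>])
  define G where "G = (\<lambda>v. sqrt (1 - (H v)^2 * v))"
  have Gpos: "1 - (H v)^2 * v > 0" if "\<bar>v\<bar> < R" for v
  proof -
    have "norm (of_real ((H v)^2 * v) :: complex) < 1/2"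
      using hsmall[of "of_real v"] hH[OF that] that by simp
    then have "\<bar>(H v)^2 * v\<bar> < 1/2"
      unfolding norm_of_real .
    then show ?thesis by linarith
  qed
  have Gan: "real_analytic_on G {-a<..<a}" if "a \<le> R" for a
  proof (rule real_analytic_on_of_holomorphic[OF _ that])
    show "(\<lambda>w. csqrt (1 - h w ^ 2 * w)) holomorphic_on ball 0 R"
    proof (intro holomorphic_intros h)
      fix w assume "w \<in> ball (0::complex) R"
      then have "Re (h w ^ 2 * w) < 1/2"
        using hsmall complex_Re_le_cmod le_less_trans by blast
      then show "1 - h w ^ 2 * w \<notin> \<real>\<^sub>\<le>\<^sub>0"
        by (simp add: complex_nonpos_Reals_iff)
    qed
    fix x :: real assume x: "\<bar>x\<bar> < R"
    have "1 - h (of_real x) ^ 2 * of_real x = of_real (1 - (H x)^2 * x)"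
      using hH[OF x] by simp
    then show "csqrt (1 - h (of_real x) ^ 2 * of_real x) = of_real (G x)"
      unfolding G_def using Gpos[OF x] by (simp add: csqrt_of_real_nonneg less_imp_le del: of_real_diff)
  qed
  have wlim: "((\<lambda>t::real. w0 * exp (2 * t)) \<longlongrightarrow> 0) at_bot"
    by real_asymp
  then have "\<forall>\<^sub>F t in at_bot. w0 * exp (2 * t) < R"
    by (rule order_tendstoD) (rule R)
  then obtain T1 where T1: "\<And>t. t \<le> T1 \<Longrightarrow> w0 * exp (2 * t) < R"
    unfolding eventually_at_bot_linorder by blast
  obtain T2 where T2: "T2 \<le> min 0 T1" "\<And>t. t < T2 \<Longrightarrow> fst (z t) = H (w0 * exp (2 * t))"
  proof (rule ew_unstable_unique[of g "min 0 T1" "\<lambda>t. fst (z t)" \<beta> w0 "\<lambda>t. H (w0 * exp (2 * t))"])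
    show "((\<lambda>t. H (w0 * exp (2 * t))) \<longlongrightarrow> 1/3) at_bot"
    proof -
      have "isCont H 0" using HD[of 0] R DERIV_isCont by auto
      from isCont_tendsto_compose[OF this wlim] show ?thesis by (simp add: H0)
    qed
    fix t assume t: "t < min 0 T1"
    have "z t = (fst (z t), w0 * exp (2 * t))" using zw[of t] t by (simp add: prod_eq_iff)
    then show "((\<lambda>t. fst (z t)) has_real_derivative fst (ew_field g \<beta> (fst (z t), w0 * exp (2 * t)))) (at t)"
      using zd[of t] t by simp
    have "\<bar>w0 * exp (2 * t)\<bar> < R" using T1[of t] t w0 by simp
    then obtain D' where D': "(H has_real_derivative D') (at (w0 * exp (2 * t)))"
      "2 * (w0 * exp (2 * t)) * D' = fst (ew_field g \<beta> (H (w0 * exp (2 * t)), w0 * exp (2 * t)))"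
      using HD by blast
    \<comment> \<open>Along w = \<open>w0 * exp (2 * t)\<close> the factor 2w of the graph equation
      is dw/dt, so the graph becomes a solution with the same w-component as
      \<open>z\<close>.\<close>
    have "((\<lambda>t. H (w0 * exp (2 * t))) has_real_derivative D' * (2 * (w0 * exp (2 * t)))) (at t)"
      by (rule DERIV_chain2[where g="\<lambda>t. w0 * exp (2 * t)"])
        (use D'(1) in \<open>auto intro!: derivative_eq_intros\<close>)
    then show "((\<lambda>t. H (w0 * exp (2 * t))) has_real_derivative
        fst (ew_field g \<beta> (H (w0 * exp (2 * t)), w0 * exp (2 * t)))) (at t)"
      using D'(2) by (simp add: mult.commute)
  qed (use contg lim\<eta> in auto)
  have "\<forall>\<^sub>F s in at_right 0. \<tau> (s + c) \<le> T2 - 1"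
    using \<tau>lim unfolding filterlim_at_bot by blast
  with evc have "\<forall>\<^sub>F s in at_right 0. s + c < 0 \<and> \<tau> (s + c) < T2"
    by eventually_elim auto
  then obtain b where b: "b > 0" "\<And>s. 0 < s \<Longrightarrow> s < b \<Longrightarrow> s + c < 0 \<and> \<tau> (s + c) < T2"
    unfolding eventually_at_right_field by auto
  \<comment> \<open>Taken strictly inside (0, b) so that \<open>early\<close> also applies at
    \<open>s0\<close> itself and yields r(s0)^2 < R.\<close>
  define s0 where "s0 = b / 2"
  have early: "snd (Y s) ^ 2 = w0 * exp (2 * \<tau> (s + c)) \<and> fst (Y s) = G (snd (Y s) ^ 2)"
    if s: "0 < s" "s < b" for s
  proof -
    have t: "\<tau> (s + c) \<le> 0" "\<tau> (s + c) < T2" and Ys: "Y s = Psi (z (\<tau> (s + c)))"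
      using b(2)[OF s] \<tau>(1)[of "s + c"] y\<tau>[of "s + c"] s by (auto simp: Y_def)
    have "snd (Y s) ^ 2 = w0 * exp (2 * \<tau> (s + c))"
      using zw[OF t(1)] w0 by (simp add: Ys Psi_def)
    then show ?thesis
      using zw[OF t(1)] T2(2)[OF t(2)] by (simp add: Ys Psi_def G_def)
  qed
  have s0: "0 < s0" "s0 < b" using b(1) by (auto simp: s0_def)
  have aR: "(snd (Y s0))^2 < R"
    using early[OF s0] T1[of "\<tau> (s0 + c)"] b(2)[OF s0] T2(1) by simp
  have "s0 \<in> D" using b(2)[OF s0] s0 by (intro inD) auto
  have "\<exists>s0\<in>D. \<exists>G. let a = (snd (Y s0))^2 in
        real_analytic_on G {-a<..<a} \<and> (\<forall>v\<in>{-a<..<a}. G v > 0) \<and>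
        (\<forall>s\<in>{0<..<s0}. fst (Y s) = G ((snd (Y s))^2))"
    unfolding Let_def
  proof (intro bexI[OF _ \<open>s0 \<in> D\<close>] exI[of _ G] conjI ballI)
    let ?a = "(snd (Y s0))^2"
    show "real_analytic_on G {-?a<..<?a}"
      using aR by (intro Gan) simp
    show "G v > 0" if "v \<in> {-?a<..<?a}" for v
      using Gpos[of v] that aR by (auto simp: G_def abs_less_iff)
    show "fst (Y s) = G ((snd (Y s))^2)" if "s \<in> {0<..<s0}" for s
      using early[of s] that s0 by auto
  qed
  moreover have "\<exists>s1>0. {0<..<s1} \<subseteq> D \<and>
        (\<forall>s\<in>{0<..<s1}. deriv (\<lambda>t. fst (Y t)) s < 0 \<and> fst (Y s) > 0)"
    using neg unfolding eventually_at_right_field by (auto simp: subset_iff)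
  moreover have "\<exists>smax::ereal. 0 < smax \<and> D = {s. 0 < s \<and> ereal s < smax}"
    unfolding D_def by (rule open_interval_ereal_bound[OF I(1,2) 0(1) low1 low2])
  moreover have "\<exists>\<eta>0>0. ((\<lambda>s. sqrt (1 - (fst (Y s))^2) / snd (Y s)) \<longlongrightarrow> \<eta>0) (at_right 0)"
    using L3 by (intro exI[of _ "1/3"]) auto
  ultimately have "toy_tip_solution g \<beta> Y D"
    unfolding toy_tip_solution_def using Ysol L1 L2 by blast
  then show ?thesis
    unfolding Y_def D_def by blast
qed

theorem theoremA5:
  fixes g :: "real \<Rightarrow> real" and \<beta> :: real
    and y :: "real \<Rightarrow> real \<times> real" and I :: "real set"
  assumes "real_analytic_on g UNIV"
    and "\<forall>v>0. g v > 0"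
    and "maximal_toy_solution g \<beta> y I"
  shows "(\<exists>c. toy_tip_solution g \<beta> (\<lambda>s. y (s + c)) ((\<lambda>s. s - c) ` I))
         \<longleftrightarrow> y ` I = Wtip g \<beta>"
proof -
  obtain g' where g': "\<And>x. (g has_real_derivative g' x) (at x)" "continuous_on UNIV g'"
    using real_analytic_C1[OF assms(1)] by blast
  show ?thesis
  proof
    assume "\<exists>c. toy_tip_solution g \<beta> (\<lambda>s. y (s + c)) ((\<lambda>s. s - c) ` I)"
    then obtain c where tip: "toy_tip_solution g \<beta> (\<lambda>s. y (s + c)) ((\<lambda>s. s - c) ` I)" by blast
    then obtain smax :: ereal where smax: "0 < smax" "(\<lambda>s. s - c) ` I = {s. 0 < s \<and> ereal s < smax}"
      unfolding toy_tip_solution_def by blast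
    \<comment> \<open>\<open>smax\<close> may be infinite; a real bound below it suffices, since
      only the behaviour near 0 is used.\<close>
    obtain b where b: "0 < ereal b" "ereal b < smax"
      using ereal_dense2[OF smax(1)] by auto
    have sub: "{0<..<b} \<subseteq> (\<lambda>s. s - c) ` I"
      unfolding smax(2) using b(2) by (auto intro: less_trans[of "ereal _" "ereal b"])
    obtain \<eta>0 where \<eta>0: "\<eta>0 > 0" "((\<lambda>s. sqrt (1 - (fst (y (s + c)))^2) / snd (y (s + c))) \<longlongrightarrow> \<eta>0) (at_right 0)"
      using tip unfolding toy_tip_solution_def by blast
    have "toy_solution g \<beta> (\<lambda>s. y (s + c)) {0<..<b}"
      using tip sub unfolding toy_tip_solution_def toy_solution_def by blast
    then obtain s where s: "s \<in> {0<..<b}" "y (s + c) \<in> Wloc g \<beta>"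
      by (rule tip_meets_Wloc[where y="\<lambda>s. y (s + c)", rotated 2])
        (use tip \<eta>0 b DERIV_isCont[OF g'(1)] in \<open>auto simp: toy_tip_solution_def\<close>)
    define s1 where "s1 = s + c"
    have s1: "s1 \<in> I" "y s1 \<in> Wloc g \<beta>"
      using s sub by (auto simp: s1_def)
    show "y ` I = Wtip g \<beta>"
    proof (intro equalityI subsetI)
      fix p assume "p \<in> y ` I"
      then obtain s where s: "s \<in> I" "p = y s" by auto
      then have "p \<in> M0"
        using assms(3) by (auto simp: maximal_toy_solution_def toy_solution_def)
      moreover have "maximal_toy_solution g \<beta> (\<lambda>t. y (t + s)) ((\<lambda>t. t - s) ` I)"
        by (rule maximal_toy_solution_shift[OF assms(3)])
      moreover have "0 \<in> (\<lambda>t. t - s) ` I" "s1 - s \<in> (\<lambda>t. t - s) ` I" "y (s1 - s + s) \<in> Wloc g \<beta>"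
        using s s1 by auto
      ultimately show "p \<in> Wtip g \<beta>"
        unfolding Wtip_def using s(2) by (auto intro!: exI[of _ "\<lambda>t. y (t + s)"] exI[of _ "(\<lambda>t. t - s) ` I"])
    next
      fix p assume "p \<in> Wtip g \<beta>"
      then obtain x J s2 where x: "maximal_toy_solution g \<beta> x J" "0 \<in> J" "x 0 = p" "s2 \<in> J" "x s2 \<in> Wloc g \<beta>"
        unfolding Wtip_def by blast
      have "y ` I = x ` J"
        by (rule Wloc_same_orbit[OF g' assms(3) s1 x(1,4,5)])
      then show "p \<in> y ` I" using x by auto
    qed
  next
    assume eq: "y ` I = Wtip g \<beta>"
    \<comment> \<open>A single point of the range is enough: it lies in \<open>Wtip\<close>, so some
      maximal solution through it meets \<open>Wloc\<close>, and \<open>y\<close> has the same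
      orbit.\<close>
    obtain s where s: "s \<in> I" using assms(3) by (auto simp: maximal_toy_solution_def)
    then have "y s \<in> Wtip g \<beta>" using eq by blast
    then obtain x J s2 where x: "maximal_toy_solution g \<beta> x J" "0 \<in> J" "x 0 = y s" "s2 \<in> J" "x s2 \<in> Wloc g \<beta>"
      unfolding Wtip_def by blast
    have "y ` I = x ` J"
      by (rule maximal_toy_solution_same_orbit[OF g' assms(3) x(1) s x(2)]) (simp add: x(3))
    then obtain s1 where s1: "s1 \<in> I" "x s2 = y s1" using x(4) by blast
    have "\<exists>c. toy_tip_solution g \<beta> (\<lambda>s. y (s + c + s1)) ((\<lambda>s. s - c) ` (\<lambda>s. s - s1) ` I)"
      by (rule Wloc_imp_tip[OF assms(1) g' maximal_toy_solution_shift[OF assms(3)]])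
        (use s1 x(5) in auto)
    then obtain c where "toy_tip_solution g \<beta> (\<lambda>s. y (s + c + s1)) ((\<lambda>s. s - c) ` (\<lambda>s. s - s1) ` I)" by blast
    then have "toy_tip_solution g \<beta> (\<lambda>s. y (s + (c + s1))) ((\<lambda>s. s - (c + s1)) ` I)"
      by (simp add: image_image add.assoc algebra_simps)
    then show "\<exists>c. toy_tip_solution g \<beta> (\<lambda>s. y (s + c)) ((\<lambda>s. s - c) ` I)" by blast
  qed
qed

end
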